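(* Let $B$ be a supersoluble brace. Then $B/\operatorname{Fit}(B)$ is finite.
   Context: A brace (skew left brace) is a set $B$ with two binary operations $+$ and $\cdot$ such that $(B,+)$ and $(B,\cdot)$ are groups and $a(b+c)=ab-a+ac$ for all $a,b,c\in B$. $\lambda_a(b)=-a+ab$ defines a homomorphism $\lambda\colon(B,\cdot)\to\operatorname{Aut}(B,+)$. An ideal is a subset that is a subgroup of both groups, normal in both, and invariant under all $\lambda_b$; quotients by ideals are braces. $\operatorname{Soc}(B)=\operatorname{Ker}\lambda\cap Z(B,+)$ and $\zeta(B)=\operatorname{Soc}(B)\cap Z(B,\cdot)$. An ideal $I$ of $B$ is $B$-centrally nilpotent if there is a finite chain $\{0\}=I_0\le\dots\le I_n=I$ of ideals of $B$ with $I_{i+1}/I_i\le\zeta(I/I_i)$ for all $i$. The Fitting ideal $\operatorname{Fit}(B)$ is the sum (additive subgroup generated) of all $B$-centrally nilpotent ideals of $B$; it is an ideal. $B$ is supersoluble if there is a finite chain of ideals $\{0\}=J_0\le\dots\le J_n=B$ such that for each $i$, either $(J_{i+1}/J_i,+)$ is infinite cyclic and $J_{i+1}/J_i\le\operatorname{Soc}(B/J_i)$, or $J_{i+1}/J_i$ has prime order. *)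

theory Defs
  imports "HOL-Algebra.Elementary_Groups" "HOL-Algebra.Generated_Groups"
          "HOL-Computational_Algebra.Primes"
begin

record 'a brace =
  bcar  :: "'a set"
  badd  :: "'a \<Rightarrow> 'a \<Rightarrow> 'a"
  bmul  :: "'a \<Rightarrow> 'a \<Rightarrow> 'a"
  bzero :: 'a
  bone  :: 'a

definition add_grp :: "'a brace \<Rightarrow> 'a monoid" where
  "add_grp B = \<lparr>carrier = bcar B, monoid.mult = badd B, one = bzero B\<rparr>"

definition mul_grp :: "'a brace \<Rightarrow> 'a monoid" where
  "mul_grp B = \<lparr>carrier = bcar B, monoid.mult = bmul B, one = bone B\<rparr>"

definition bneg :: "'a brace \<Rightarrow> 'a \<Rightarrow> 'a" where
  "bneg B a = inv\<^bsub>add_grp B\<^esub> a"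

definition is_brace :: "'a brace \<Rightarrow> bool" where
  "is_brace B \<longleftrightarrow> group (add_grp B) \<and> group (mul_grp B) \<and>
     (\<forall>a\<in>bcar B. \<forall>b\<in>bcar B. \<forall>c\<in>bcar B.
        bmul B a (badd B b c) = badd B (badd B (bmul B a b) (bneg B a)) (bmul B a c))"

definition blam :: "'a brace \<Rightarrow> 'a \<Rightarrow> 'a \<Rightarrow> 'a" where
  "blam B a b = badd B (bneg B a) (bmul B a b)"

definition brace_ideal :: "'a set \<Rightarrow> 'a brace \<Rightarrow> bool" where
  "brace_ideal I B \<longleftrightarrow> normal I (add_grp B) \<and> normal I (mul_grp B) \<and>
     (\<forall>b\<in>bcar B. \<forall>x\<in>I. blam B b x \<in> I)"

definition quot :: "'a brace \<Rightarrow> 'a set \<Rightarrow> 'a set brace" where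
  "quot B I = \<lparr>bcar = rcosets\<^bsub>add_grp B\<^esub> I,
               badd = set_mult (add_grp B),
               bmul = set_mult (mul_grp B),
               bzero = I, bone = I\<rparr>"

definition quot_img :: "'a brace \<Rightarrow> 'a set \<Rightarrow> 'a set \<Rightarrow> 'a set set" where
  "quot_img B J I = (\<lambda>x. I #>\<^bsub>add_grp B\<^esub> x) ` J"

definition sub_brace :: "'a brace \<Rightarrow> 'a set \<Rightarrow> 'a brace" where
  "sub_brace B I = B\<lparr>bcar := I\<rparr>"

definition soc :: "'a brace \<Rightarrow> 'a set" where
  "soc B = {a \<in> bcar B. (\<forall>b\<in>bcar B. blam B a b = b) \<and>
                         (\<forall>b\<in>bcar B. badd B a b = badd B b a)}"

definition zeta :: "'a brace \<Rightarrow> 'a set" where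
  "zeta B = soc B \<inter> {a \<in> bcar B. \<forall>b\<in>bcar B. bmul B a b = bmul B b a}"

definition centrally_nilpotent_ideal :: "'a brace \<Rightarrow> 'a set \<Rightarrow> bool" where
  "centrally_nilpotent_ideal B I \<longleftrightarrow> brace_ideal I B \<and>
     (\<exists>(C :: nat \<Rightarrow> 'a set) n. C 0 = {bzero B} \<and> C n = I \<and>
        (\<forall>i\<le>n. brace_ideal (C i) B) \<and>
        (\<forall>i<n. C i \<subseteq> C (Suc i) \<and>
               quot_img B (C (Suc i)) (C i) \<subseteq> zeta (quot (sub_brace B I) (C i))))"

definition Fit :: "'a brace \<Rightarrow> 'a set" where
  "Fit B = generate (add_grp B) (\<Union>{I. centrally_nilpotent_ideal B I})"

definition supersoluble :: "'a brace \<Rightarrow> bool" where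
  "supersoluble B \<longleftrightarrow>
     (\<exists>(J :: nat \<Rightarrow> 'a set) n. J 0 = {bzero B} \<and> J n = bcar B \<and>
        (\<forall>i\<le>n. brace_ideal (J i) B) \<and>
        (\<forall>i<n. J i \<subseteq> J (Suc i) \<and>
           (let Q = quot (sub_brace B (J (Suc i))) (J i) in
             (infinite (bcar Q) \<and> cyclic_group (add_grp Q) \<and>
                bcar Q \<subseteq> soc (quot B (J i)))
             \<or> Factorial_Ring.prime (card (bcar Q)))))"

end

theory Submission
  imports Defs "HOL-Algebra.Multiplicative_Group"
begin

text \<open>
  Let \<open>0 = J\<^sub>0 \<le> \<dots> \<le> J\<^sub>n = B\<close> be a supersoluble chain and let \<open>H\<close> be the set of all \<open>b\<close> for
  which \<open>\<lambda>\<^sub>b\<close> acts trivially on every infinite factor. On such a factor \<open>\<lambda>\<close> acts by signs, so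
  \<open>H\<close> is closed under multiplication and contains all squares. One constructs ideals
  \<open>M\<^sub>0 \<le> M\<^sub>1 \<le> \<dots>\<close> of \<open>B\<close> with \<open>M\<^sub>i \<subseteq> J\<^sub>i \<inter> H\<close> of finite index in \<open>J\<^sub>i\<close>, such that
  \<open>M\<^sub>i\<^sub>+\<^sub>1/M\<^sub>i\<close> lies in the socle of \<open>B/M\<^sub>i\<close> and is centralised by \<open>H\<close>; then \<open>M\<^sub>n\<close> is centrally
  nilpotent of finite index and contained in the Fitting ideal.

  At a finite factor take \<open>M\<^sub>i\<^sub>+\<^sub>1 = M\<^sub>i\<close>. At an infinite one, work in \<open>C = B/M\<^sub>i\<close> with the finite ideal
  \<open>E = J\<^sub>i/M\<^sub>i\<close> of order \<open>e\<close> and \<open>J = J\<^sub>i\<^sub>+\<^sub>1/M\<^sub>i\<close>, and let \<open>M\<^sub>i\<^sub>+\<^sub>1\<close> be the preimage of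
  \<open>K = 2e (Soc(C) \<inter> J)\<close>. The factor \<open>2\<close> makes the elements of \<open>K\<close> squares, which puts \<open>M\<^sub>i\<^sub>+\<^sub>1\<close>
  into \<open>H\<close>. The factor \<open>e\<close> gives \<open>K \<inter> E = 0\<close>, so that \<open>H\<close>, which centralises \<open>J/E\<close>, centralises \<open>K\<close>.
  The index of \<open>K\<close> in \<open>J\<close> is finite because \<open>Soc(C) \<inter> J\<close> contains an element of infinite order:
  \<open>J\<close> acts on \<open>(C,+)\<close>, by \<open>\<lambda>\<close> and by conjugation, trivially modulo the finite \<open>E\<close>, and as
  \<open>(C,+)\<close> is finitely generated there are only finitely many such automorphisms.
\<close>

section \<open>The two groups of a brace and the action \<open>lam\<close>\<close>

lemma carrier_add_grp [simp]: "carrier (add_grp B) = bcar B"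
  and mult_add_grp [simp]: "monoid.mult (add_grp B) = badd B"
  and one_add_grp [simp]: "one (add_grp B) = bzero B"
  and carrier_mul_grp [simp]: "carrier (mul_grp B) = bcar B"
  and mult_mul_grp [simp]: "monoid.mult (mul_grp B) = bmul B"
  and one_mul_grp [simp]: "one (mul_grp B) = bone B"
  by (simp_all add: add_grp_def mul_grp_def)

lemma inv_add_grp [simp]: "m_inv (add_grp B) = bneg B"
  by (simp add: bneg_def fun_eq_iff)

locale skew_brace =
  fixes B :: "'a brace"
  assumes is_brace: "is_brace B"
begin

abbreviation plus (infixl "\<boxplus>" 65) where "x \<boxplus> y \<equiv> badd B x y"
abbreviation times (infixl "\<boxdot>" 70) where "x \<boxdot> y \<equiv> bmul B x y"
abbreviation neg ("\<boxminus> _" [81] 80) where "\<boxminus> x \<equiv> bneg B x"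
abbreviation zero ("\<^bold>0") where "\<^bold>0 \<equiv> bzero B"
abbreviation recip where "recip x \<equiv> inv\<^bsub>mul_grp B\<^esub> x"
abbreviation scale (infixr "\<cdot>" 75) where "k \<cdot> x \<equiv> x [^]\<^bsub>add_grp B\<^esub> k"
abbreviation lam where "lam \<equiv> blam B"
abbreviation coset where "coset I x \<equiv> I #>\<^bsub>add_grp B\<^esub> x"

sublocale add: group "add_grp B"
  rewrites "carrier (add_grp B) = bcar B" and "monoid.mult (add_grp B) = badd B"
    and "one (add_grp B) = bzero B" and "m_inv (add_grp B) = bneg B"
  using is_brace by (simp_all add: is_brace_def)

text \<open>The brace law at a = 1 and b = c = 0 collapses to 0 = -1, where 1 is
  \<open>bone B\<close>.\<close>

lemma bone_eq_zero [simp]: "bone B = \<^bold>0"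
proof -
  interpret M: group "mul_grp B" using is_brace by (simp add: is_brace_def)
  have 1: "bone B \<in> bcar B" using M.one_closed by simp
  have 2: "\<^bold>0 \<in> bcar B" by simp
  have "bmul B (bone B) (badd B \<^bold>0 \<^bold>0) =
        badd B (badd B (bmul B (bone B) \<^bold>0) (bneg B (bone B))) (bmul B (bone B) \<^bold>0)"
    using is_brace 1 2 unfolding is_brace_def by blast
  then have "\<^bold>0 = \<boxminus> bone B"
    using M.l_one[of "\<^bold>0"] 1 by simp
  then show ?thesis using 1 by (metis add.inv_inv add.inv_one)
qed

sublocale mul: group "mul_grp B"
  rewrites "carrier (mul_grp B) = bcar B" and "monoid.mult (mul_grp B) = bmul B"
    and "one (mul_grp B) = bzero B"
  using is_brace by (simp_all add: is_brace_def)

lemma neg_plus_cancel [simp]: "x \<in> bcar B \<Longrightarrow> y \<in> bcar B \<Longrightarrow> \<boxminus> x \<boxplus> (x \<boxplus> y) = y"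
  and plus_neg_cancel [simp]: "x \<in> bcar B \<Longrightarrow> y \<in> bcar B \<Longrightarrow> x \<boxplus> (\<boxminus> x \<boxplus> y) = y"
  by (simp_all add: add.m_assoc[symmetric])

lemma distrib:
  assumes "a \<in> bcar B" "b \<in> bcar B" "c \<in> bcar B"
  shows "a \<boxdot> (b \<boxplus> c) = a \<boxdot> b \<boxplus> \<boxminus> a \<boxplus> a \<boxdot> c"
  using is_brace assms by (simp add: is_brace_def)

lemma lam_closed [simp, intro]:
  "a \<in> bcar B \<Longrightarrow> b \<in> bcar B \<Longrightarrow> lam a b \<in> bcar B"
  by (simp add: blam_def)

lemma times_conv_lam: "a \<in> bcar B \<Longrightarrow> b \<in> bcar B \<Longrightarrow> a \<boxdot> b = a \<boxplus> lam a b"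
  by (simp add: blam_def add.m_assoc[symmetric])

lemma lam_plus:
  assumes "a \<in> bcar B" "b \<in> bcar B" "c \<in> bcar B"
  shows "lam a (b \<boxplus> c) = lam a b \<boxplus> lam a c"
  using assms by (simp add: blam_def distrib add.m_assoc)

lemma lam_hom: "a \<in> bcar B \<Longrightarrow> lam a \<in> hom (add_grp B) (add_grp B)"
  by (simp add: hom_def lam_plus)

lemma lam_group_hom: "a \<in> bcar B \<Longrightarrow> group_hom (add_grp B) (add_grp B) (lam a)"
  by (simp add: group_hom_def group_hom_axioms_def lam_hom add.is_group)

lemma lam_zero [simp]: "a \<in> bcar B \<Longrightarrow> lam a \<^bold>0 = \<^bold>0"
  using group_hom.hom_one[OF lam_group_hom, of a] by simp

lemma lam_int_pow:
  "a \<in> bcar B \<Longrightarrow> b \<in> bcar B \<Longrightarrow> lam a ((k::int) \<cdot> b) = k \<cdot> lam a b"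
  using group_hom.hom_int_pow[OF lam_group_hom, of a b k] by simp

lemma lam_nat_pow:
  "a \<in> bcar B \<Longrightarrow> b \<in> bcar B \<Longrightarrow> lam a ((k::nat) \<cdot> b) = k \<cdot> lam a b"
  using group_hom.hom_nat_pow[OF lam_group_hom, of a b k] by simp

lemma zero_lam [simp]: "b \<in> bcar B \<Longrightarrow> lam \<^bold>0 b = b"
  by (simp add: blam_def)

text \<open>Expanding (ab)c = a(bc) on both sides by \<open>times_conv_lam\<close> produces the
  common left summand ab, which cancels.\<close>

lemma lam_times:
  assumes "a \<in> bcar B" "b \<in> bcar B" "c \<in> bcar B"
  shows "lam (a \<boxdot> b) c = lam a (lam b c)"
proof -
  have "a \<boxdot> b \<boxplus> lam (a \<boxdot> b) c = a \<boxdot> (b \<boxdot> c)"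
    using assms by (simp add: times_conv_lam[symmetric] mul.m_assoc)
  also have "\<dots> = a \<boxplus> lam a (b \<boxplus> lam b c)"
    using assms by (simp add: times_conv_lam)
  also have "\<dots> = a \<boxdot> b \<boxplus> lam a (lam b c)"
    using assms by (simp add: times_conv_lam lam_plus add.m_assoc)
  finally show ?thesis using assms by simp
qed

lemma lam_recip_lam [simp]: "a \<in> bcar B \<Longrightarrow> b \<in> bcar B \<Longrightarrow> lam (recip a) (lam a b) = b"
  and lam_lam_recip [simp]: "a \<in> bcar B \<Longrightarrow> b \<in> bcar B \<Longrightarrow> lam a (lam (recip a) b) = b"
  by (simp_all add: lam_times[symmetric])

lemma lam_inject: "\<lbrakk>a \<in> bcar B; b \<in> bcar B; c \<in> bcar B; lam a b = lam a c\<rbrakk> \<Longrightarrow> b = c"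
  by (metis lam_recip_lam)

lemma plus_conv_times:
  assumes "a \<in> bcar B" "b \<in> bcar B"
  shows "a \<boxplus> b = a \<boxdot> lam (recip a) b"
  using assms by (simp add: times_conv_lam)

lemma coset_zero: "I \<subseteq> bcar B \<Longrightarrow> coset I \<^bold>0 = I"
  using add.coset_mult_one by simp

lemma coset_eq_iff:
  assumes "subgroup I (add_grp B)" "x \<in> bcar B" "y \<in> bcar B"
  shows "coset I x = coset I y \<longleftrightarrow> x \<boxplus> \<boxminus> y \<in> I"
  using assms add.repr_independence[of x I y] add.repr_independenceD[of I x y]
    subgroup.rcos_module[OF assms(1) add.is_group, of y x] by auto

lemma coset_eq_self_iff:
  assumes "subgroup I (add_grp B)" "x \<in> bcar B"
  shows "coset I x = I \<longleftrightarrow> x \<in> I"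
  using assms add.coset_join1 add.coset_join2 by metis

end

section \<open>Ideals and their cosets\<close>

locale skew_brace_ideal = skew_brace +
  fixes I assumes ideal: "brace_ideal I B"
begin

sublocale add: normal I "add_grp B"
  rewrites "carrier (add_grp B) = bcar B" and "monoid.mult (add_grp B) = badd B"
    and "one (add_grp B) = bzero B" and "m_inv (add_grp B) = bneg B"
  using ideal by (simp_all add: brace_ideal_def)

sublocale mul: normal I "mul_grp B"
  rewrites "carrier (mul_grp B) = bcar B" and "monoid.mult (mul_grp B) = bmul B"
    and "one (mul_grp B) = bzero B"
  using ideal by (simp_all add: brace_ideal_def)

lemma lam_ideal: "b \<in> bcar B \<Longrightarrow> x \<in> I \<Longrightarrow> lam b x \<in> I"
  using ideal by (simp add: brace_ideal_def)

text \<open>The left cosets agree because xi = x + \<open>lam x i\<close> and \<open>lam x\<close>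
  permutes the ideal; normality in both groups turns them into right cosets. Hence
  \<open>quot\<close>, whose carrier consists of additive cosets, is a quotient of the
  multiplicative group as well.\<close>

lemma mul_coset_eq_coset:
  assumes "x \<in> bcar B" shows "I #>\<^bsub>mul_grp B\<^esub> x = coset I x"
proof -
  have "I #>\<^bsub>mul_grp B\<^esub> x = x <#\<^bsub>mul_grp B\<^esub> I"
    using mul.coset_eq assms by simp
  also have "\<dots> = x <#\<^bsub>add_grp B\<^esub> I"
  proof (intro equalityI subsetI)
    fix y assume "y \<in> x <#\<^bsub>mul_grp B\<^esub> I"
    then obtain i where "i \<in> I" "y = x \<boxdot> i" by (auto simp: l_coset_def)
    then show "y \<in> x <#\<^bsub>add_grp B\<^esub> I"
      using assms lam_ideal by (auto simp: l_coset_def times_conv_lam)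
  next
    fix y assume "y \<in> x <#\<^bsub>add_grp B\<^esub> I"
    then obtain i where "i \<in> I" "y = x \<boxplus> i" by (auto simp: l_coset_def)
    then show "y \<in> x <#\<^bsub>mul_grp B\<^esub> I"
      using assms lam_ideal by (auto simp: l_coset_def plus_conv_times)
  qed
  also have "\<dots> = coset I x" using add.coset_eq assms by simp
  finally show ?thesis .
qed

end

section \<open>Surjective brace homomorphisms\<close>

locale brace_epi = skew_brace B + cod: skew_brace D for B :: "'a brace" and D :: "'b brace" +
  fixes h
  assumes surj: "h ` bcar B = bcar D"
    and hom_plus: "\<And>x y. x \<in> bcar B \<Longrightarrow> y \<in> bcar B \<Longrightarrow> h (badd B x y) = badd D (h x) (h y)"
    and hom_times: "\<And>x y. x \<in> bcar B \<Longrightarrow> y \<in> bcar B \<Longrightarrow> h (bmul B x y) = bmul D (h x) (h y)"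
begin

sublocale add: group_hom "add_grp B" "add_grp D" h
  rewrites "carrier (add_grp B) = bcar B" and "monoid.mult (add_grp B) = badd B"
    and "one (add_grp B) = bzero B" and "m_inv (add_grp B) = bneg B"
    and "carrier (add_grp D) = bcar D" and "monoid.mult (add_grp D) = badd D"
    and "one (add_grp D) = bzero D" and "m_inv (add_grp D) = bneg D"
  using surj by unfold_locales (auto simp: hom_def hom_plus)

sublocale mul: group_hom "mul_grp B" "mul_grp D" h
  rewrites "carrier (mul_grp B) = bcar B" and "monoid.mult (mul_grp B) = bmul B"
    and "one (mul_grp B) = bzero B"
    and "carrier (mul_grp D) = bcar D" and "monoid.mult (mul_grp D) = bmul D"
    and "one (mul_grp D) = bzero D"
  using surj by unfold_locales (auto simp: hom_def hom_times)

lemma hom_lam: "a \<in> bcar B \<Longrightarrow> b \<in> bcar B \<Longrightarrow> h (blam B a b) = blam D (h a) (h b)"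
  by (simp add: blam_def hom_plus hom_times)

lemma ideal_image:
  assumes "brace_ideal I B" shows "brace_ideal (h ` I) D"
proof -
  interpret I: skew_brace_ideal B I by unfold_locales fact
  have "normal (h ` I) (add_grp D)"
    using I.add.surj_hom_normal_subgroup[OF add.group_hom_axioms] surj by simp
  moreover have "normal (h ` I) (mul_grp D)"
    using I.mul.surj_hom_normal_subgroup[OF mul.group_hom_axioms] surj by simp
  moreover have "blam D b x \<in> h ` I" if b: "b \<in> bcar D" and x: "x \<in> h ` I" for b x
  proof -
    obtain b' x' where "b = h b'" "b' \<in> bcar B" "x = h x'" "x' \<in> I"
      using b x surj by blast
    then show ?thesis using I.lam_ideal I.add.subset hom_lam by (metis imageI subsetD)
  qed
  ultimately show ?thesis by (simp add: brace_ideal_def)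
qed

lemma ideal_vimage:
  assumes "brace_ideal K D" shows "brace_ideal {x \<in> bcar B. h x \<in> K} B"
proof -
  interpret K: skew_brace_ideal D K by unfold_locales fact
  let ?V = "{x \<in> bcar B. h x \<in> K}"
  have "subgroup ?V (add_grp B)"
    by (rule subgroup.intro) (simp_all add: subset_iff hom_plus)
  moreover have "x \<boxplus> v \<boxplus> \<boxminus> x \<in> ?V" if "x \<in> bcar B" "v \<in> ?V" for x v
    using that K.add.inv_op_closed2[of "h x" "h v"] by (simp add: hom_plus)
  ultimately have "normal ?V (add_grp B)"
    using group.normal_invI[of "add_grp B" ?V] add.is_group by simp
  moreover have "subgroup ?V (mul_grp B)"
    by (rule subgroup.intro) (simp_all add: subset_iff hom_times)
  moreover have "x \<boxdot> v \<boxdot> recip x \<in> ?V" if "x \<in> bcar B" "v \<in> ?V" for x v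
    using that K.mul.inv_op_closed2[of "h x" "h v"] by (simp add: hom_times)
  ultimately have "normal ?V (mul_grp B)"
    using group.normal_invI[of "mul_grp B" ?V] mul.is_group by simp
  with \<open>normal ?V (add_grp B)\<close> show ?thesis
    using K.lam_ideal by (simp add: brace_ideal_def hom_lam)
qed

end

section \<open>Quotient braces and congruences modulo an ideal\<close>

lemma bcar_quot: "bcar (quot B I) = quot_img B (bcar B) I"
  by (auto simp: quot_def quot_img_def RCOSETS_def)

lemma add_grp_sub_brace: "add_grp (sub_brace B J) = (add_grp B)\<lparr>carrier := J\<rparr>"
  by (simp add: add_grp_def sub_brace_def)

text \<open>Cosets and products of sets depend on the operations alone, so forming J/I only shrinks
  the carrier of B/I. Factors of a chain can thus be studied inside a quotient of the whole
  brace.\<close>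

lemma quot_sub_brace: "quot (sub_brace B J) I = sub_brace (quot B I) (quot_img B J I)"
  by (auto simp: quot_def sub_brace_def quot_img_def RCOSETS_def r_coset_def set_mult_def
      add_grp_def mul_grp_def fun_eq_iff)

context skew_brace_ideal
begin

lemma add_grp_quot: "add_grp (quot B I) = add_grp B Mod I"
  by (simp add: add_grp_def quot_def FactGroup_def)

lemma mul_grp_quot: "mul_grp (quot B I) = mul_grp B Mod I"
proof -
  have "rcosets\<^bsub>add_grp B\<^esub> I = rcosets\<^bsub>mul_grp B\<^esub> I"
    by (simp add: RCOSETS_def mul_coset_eq_coset)
  then show ?thesis by (simp add: mul_grp_def quot_def FactGroup_def)
qed

lemma quot_plus:
  assumes "x \<in> bcar B" "y \<in> bcar B"
  shows "badd (quot B I) (coset I x) (coset I y) = coset I (x \<boxplus> y)"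
  using add.rcos_sum assms by (simp add: quot_def)

lemma quot_times:
  assumes "x \<in> bcar B" "y \<in> bcar B"
  shows "bmul (quot B I) (coset I x) (coset I y) = coset I (x \<boxdot> y)"
  using mul.rcos_sum assms by (simp add: quot_def mul_coset_eq_coset)

lemma quot_neg:
  assumes "x \<in> bcar B"
  shows "bneg (quot B I) (coset I x) = coset I (\<boxminus> x)"
proof -
  have "coset I x \<in> carrier (add_grp B Mod I)"
    using assms add.rcosetsI[OF add.subset] by (simp add: FactGroup_def)
  then show ?thesis
    using add.inv_FactGroup add.rcos_inv assms by (simp only: bneg_def add_grp_quot)
qed

lemma is_brace_quot: "is_brace (quot B I)"
  unfolding is_brace_def
proof (intro conjI ballI)
  show "group (add_grp (quot B I))" "group (mul_grp (quot B I))"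
    by (simp_all add: add_grp_quot mul_grp_quot add.factorgroup_is_group mul.factorgroup_is_group)
next
  fix a b c assume "a \<in> bcar (quot B I)" "b \<in> bcar (quot B I)" "c \<in> bcar (quot B I)"
  then obtain x y z where "x \<in> bcar B" "a = coset I x" "y \<in> bcar B" "b = coset I y"
    "z \<in> bcar B" "c = coset I z" by (auto simp: bcar_quot quot_img_def)
  then show "bmul (quot B I) a (badd (quot B I) b c) =
    badd (quot B I) (badd (quot B I) (bmul (quot B I) a b) (bneg (quot B I) a)) (bmul (quot B I) a c)"
    by (simp add: quot_plus quot_times quot_neg distrib)
qed

lemma brace_epi_quot: "brace_epi B (quot B I) (coset I)"
  by (intro brace_epi.intro brace_epi_axioms.intro skew_brace_axioms skew_brace.intro is_brace_quot)
    (simp_all add: quot_plus quot_times bcar_quot quot_img_def)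

lemma coset_plus_cong:
  assumes "coset I x = coset I x'" "coset I y = coset I y'"
    and "x \<in> bcar B" "x' \<in> bcar B" "y \<in> bcar B" "y' \<in> bcar B"
  shows "coset I (x \<boxplus> y) = coset I (x' \<boxplus> y')"
  using assms by (metis quot_plus)

lemma coset_neg_cong:
  assumes "coset I x = coset I x'" and "x \<in> bcar B" "x' \<in> bcar B"
  shows "coset I (\<boxminus> x) = coset I (\<boxminus> x')"
  using assms by (metis quot_neg)

lemma coset_scale_cong:
  fixes k :: int
  assumes "coset I x = coset I x'" and "x \<in> bcar B" "x' \<in> bcar B"
  shows "coset I (k \<cdot> x) = coset I (k \<cdot> x')"
proof -
  interpret q: brace_epi B "quot B I" "coset I" by (rule brace_epi_quot)
  show ?thesis using q.add.hom_int_pow assms by metis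
qed

lemma coset_eq: "x \<in> bcar B \<Longrightarrow> y \<in> bcar B \<Longrightarrow> coset I x = coset I y \<longleftrightarrow> x \<boxplus> \<boxminus> y \<in> I"
  using coset_eq_iff add.subgroup_axioms by blast

lemma coset_eq_self: "x \<in> bcar B \<Longrightarrow> coset I x = I \<longleftrightarrow> x \<in> I"
  using coset_eq_self_iff add.subgroup_axioms by blast

lemma mem_coset_iff: "x \<in> bcar B \<Longrightarrow> y \<in> bcar B \<Longrightarrow> x \<in> coset I y \<longleftrightarrow> coset I x = coset I y"
  using add.repr_independence add.rcos_self add.subgroup_axioms by metis

end

section \<open>The socle and the ideals contained in it\<close>

context skew_brace
begin

lemma socD:
  assumes "a \<in> soc B"
  shows "a \<in> bcar B" and "\<And>b. b \<in> bcar B \<Longrightarrow> lam a b = b"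
    and "\<And>b. b \<in> bcar B \<Longrightarrow> a \<boxplus> b = b \<boxplus> a"
  using assms by (auto simp: soc_def)

lemma soc_times: "a \<in> soc B \<Longrightarrow> b \<in> bcar B \<Longrightarrow> a \<boxdot> b = a \<boxplus> b"
  by (simp add: times_conv_lam socD)

text \<open>The automorphism \<open>lam b\<close> preserves additive centrality. The conjugate c of
  a by b lies in the kernel of lambda, so c + b = cb = ba = b + \<open>lam b a\<close> =
  \<open>lam b a\<close> + b, and b cancels. On the socle, multiplicative conjugation is therefore
  lambda.\<close>

lemma conj_soc:
  assumes a: "a \<in> soc B" and b: "b \<in> bcar B"
  shows "b \<boxdot> a \<boxdot> recip b = lam b a" and "lam b a \<in> soc B"
proof -
  have aB: "a \<in> bcar B" using a socD by blast
  have central: "lam b a \<boxplus> c = c \<boxplus> lam b a" if c: "c \<in> bcar B" for c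
  proof -
    have "lam b (a \<boxplus> lam (recip b) c) = lam b (lam (recip b) c \<boxplus> a)"
      using socD(3)[OF a, of "lam (recip b) c"] b c by simp
    then show ?thesis using aB b c by (simp add: lam_plus)
  qed
  define c where "c = b \<boxdot> a \<boxdot> recip b"
  have cB: "c \<in> bcar B" using aB b by (simp add: c_def)
  have lam_c: "lam c d = d" if "d \<in> bcar B" for d
    using that a b aB by (simp add: c_def lam_times socD)
  have "c \<boxplus> b = c \<boxdot> b" using cB b by (simp add: times_conv_lam lam_c)
  also have "\<dots> = b \<boxdot> a" using aB b by (simp add: c_def mul.m_assoc)
  also have "\<dots> = lam b a \<boxplus> b" using aB b central by (simp add: times_conv_lam)
  finally have "c = lam b a" using aB b cB by simp
  then show "b \<boxdot> a \<boxdot> recip b = lam b a" "lam b a \<in> soc B"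
    using lam_c central cB by (auto simp: c_def soc_def)
qed

text \<open>Sums of socle elements are products and negatives are multiplicative inverses, so the
  kernel of lambda is respected by the additive operations.\<close>

lemma subgroup_soc: "subgroup (soc B) (add_grp B)"
proof (rule subgroup.intro)
  fix x y assume xy: "x \<in> soc B" "y \<in> soc B"
  then have xyB: "x \<in> bcar B" "y \<in> bcar B" by (simp_all add: socD)
  have "lam (x \<boxplus> y) b = b" if "b \<in> bcar B" for b
    using that xy xyB by (simp add: soc_times[symmetric] lam_times socD)
  moreover have "x \<boxplus> y \<boxplus> b = b \<boxplus> (x \<boxplus> y)" if "b \<in> bcar B" for b
    using that xy xyB by (metis add.m_assoc socD(3))
  ultimately show "x \<otimes>\<^bsub>add_grp B\<^esub> y \<in> soc B" using xyB by (simp add: soc_def)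
next
  fix x assume x: "x \<in> soc B"
  then have xB: "x \<in> bcar B" by (simp add: socD)
  have "x \<boxplus> recip x = \<^bold>0" using x xB soc_times[symmetric] by simp
  then have "\<boxminus> x = recip x" using xB by (metis add.inv_equality add.inv_inv add.inv_closed mul.inv_closed)
  then have "lam (\<boxminus> x) b = b" if "b \<in> bcar B" for b
    using that x xB lam_recip_lam[of x b] by (simp add: socD)
  moreover have "\<boxminus> x \<boxplus> b = b \<boxplus> \<boxminus> x" if "b \<in> bcar B" for b
    using that x xB by (metis add.inv_closed add.inv_solve_left add.inv_solve_right add.m_assoc add.m_closed socD(3))
  ultimately show "inv\<^bsub>add_grp B\<^esub> x \<in> soc B" using xB by (simp add: soc_def)
qed (auto simp: soc_def)

text \<open>Inside the socle, additive normality is centrality, multiplicative closure is additive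
  closure, and multiplicative normality is invariance under lambda by
  \<open>conj_soc\<close>.\<close>

lemma brace_ideal_if_subset_soc:
  assumes sub: "subgroup K (add_grp B)" and soc: "K \<subseteq> soc B"
    and lam: "\<And>b x. b \<in> bcar B \<Longrightarrow> x \<in> K \<Longrightarrow> lam b x \<in> K"
  shows "brace_ideal K B"
proof -
  have KB: "x \<in> bcar B" if "x \<in> K" for x using that soc socD by blast
  have "b \<boxplus> x \<boxplus> \<boxminus> b \<in> K" if "b \<in> bcar B" "x \<in> K" for b x
  proof -
    have "b \<boxplus> x = x \<boxplus> b" using that soc socD by (metis subsetD)
    then show ?thesis using that KB by (simp add: add.m_assoc)
  qed
  then have "normal K (add_grp B)"
    using group.normal_invI[of "add_grp B" K] sub add.is_group by simp
  moreover have "subgroup K (mul_grp B)"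
  proof (rule subgroup.intro)
    fix x assume "x \<in> K"
    have "recip x = \<boxminus> x"
      using \<open>x \<in> K\<close> soc KB soc_times by (metis mul.inv_equality subgroup.m_inv_closed[OF subgroup_soc] inv_add_grp add.l_inv add.inv_closed subsetD)
    then show "inv\<^bsub>mul_grp B\<^esub> x \<in> K"
      using subgroup.m_inv_closed[OF sub] \<open>x \<in> K\<close> by simp
  next
    fix x y assume "x \<in> K" "y \<in> K"
    then have "x \<boxdot> y = x \<boxplus> y" using soc KB soc_times by blast
    then show "x \<otimes>\<^bsub>mul_grp B\<^esub> y \<in> K"
      using subgroup.m_closed[OF sub \<open>x \<in> K\<close> \<open>y \<in> K\<close>] by simp
  next
    show "\<one>\<^bsub>mul_grp B\<^esub> \<in> K" using subgroup.one_closed[OF sub] by simp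
  qed (use KB in auto)
  then have "normal K (mul_grp B)"
    using group.normal_invI[of "mul_grp B" K] mul.is_group soc lam conj_soc by (auto simp: subset_iff)
  ultimately show ?thesis using lam by (simp add: brace_ideal_def)
qed

section \<open>Socle elements found by the pigeonhole principle\<close>

lemma hom_eq_on_generate:
  assumes "f \<in> hom (add_grp B) (add_grp B)" "g \<in> hom (add_grp B) (add_grp B)"
    and X: "X \<subseteq> bcar B" and "\<And>x. x \<in> X \<Longrightarrow> f x = g x"
    and "x \<in> generate (add_grp B) X"
  shows "f x = g x"
proof -
  interpret f: group_hom "add_grp B" "add_grp B" f
    using assms(1) by (simp add: group_hom_def group_hom_axioms_def add.is_group)
  interpret g: group_hom "add_grp B" "add_grp B" g
    using assms(2) by (simp add: group_hom_def group_hom_axioms_def add.is_group)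
  from assms(5) show ?thesis
  proof induction
    case one
    show ?case using f.hom_one g.hom_one by simp
  next
    case (incl h)
    then show ?case using assms(4) by simp
  next
    case (inv h)
    then show ?case using assms(4) X f.hom_inv[of h] g.hom_inv[of h] by auto
  next
    case (eng h1 h2)
    then show ?case
      using f.hom_mult[of h1 h2] g.hom_mult[of h1 h2] add.generate_in_carrier X by simp
  qed
qed

text \<open>Each \<open>f n\<close> is determined by its values on the finite set \<open>X\<close>,
  and each of these values ranges over a finite coset of \<open>E\<close>. So only finitely many
  maps occur in the sequence.\<close>

lemma pigeonhole_hom:
  fixes f :: "nat \<Rightarrow> 'a \<Rightarrow> 'a"
  assumes f: "\<And>n. f n \<in> hom (add_grp B) (add_grp B)"
    and X: "finite X" "X \<subseteq> bcar B" "generate (add_grp B) X = bcar B" and "finite E"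
    and E: "\<And>n x. x \<in> X \<Longrightarrow> f n x \<in> coset E x"
  shows "\<exists>i j. i < j \<and> (\<forall>b\<in>bcar B. f i b = f j b)"
proof -
  have "finite (coset E x)" for x using \<open>finite E\<close> by (simp add: r_coset_def)
  moreover have "range (\<lambda>n. restrict (f n) X) \<subseteq> Pi\<^sub>E X (coset E)" using E by auto
  ultimately have "finite (range (\<lambda>n. restrict (f n) X))"
    using X finite_PiE finite_subset by metis
  then have "\<not> inj (\<lambda>n. restrict (f n) X)" using finite_imageD infinite_UNIV_nat by blast
  then obtain i j where ij: "i \<noteq> j" "restrict (f i) X = restrict (f j) X" by (auto simp: inj_def)
  then have "f i x = f j x" if "x \<in> X" for x using that by (metis restrict_apply')
  then have "f i b = f j b" if "b \<in> bcar B" for b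
    using hom_eq_on_generate[OF f f] that X by metis
  with ij show ?thesis by (metis linorder_neq_iff)
qed

text \<open>Two applications of the pigeonhole principle: one to the lambda action of the powers of
  \<open>t\<close>, giving a power \<open>u\<close> in the kernel of lambda, and one to conjugation
  by the multiples of \<open>u\<close>, giving an additively central multiple \<open>s\<close>. If
  \<open>t\<close> has infinite order modulo \<open>E\<close>, then so has \<open>s\<close>.\<close>

lemma ex_soc_multiple:
  assumes E: "brace_ideal E B" "finite E" and J: "brace_ideal J B" and t: "t \<in> J"
    and lamE: "\<And>x b. x \<in> J \<Longrightarrow> b \<in> bcar B \<Longrightarrow> coset E (lam x b) = coset E b"
    and comE: "\<And>x b. x \<in> J \<Longrightarrow> b \<in> bcar B \<Longrightarrow> coset E (x \<boxplus> b) = coset E (b \<boxplus> x)"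
    and X: "finite X" "X \<subseteq> bcar B" "generate (add_grp B) X = bcar B"
  obtains s m where "s \<in> soc B" "s \<in> J" "m > (0::nat)" "coset E s = coset E (m \<cdot> t)"
proof -
  interpret E: skew_brace_ideal B E by unfold_locales fact
  interpret J: skew_brace_ideal B J by unfold_locales fact
  have JB: "x \<in> bcar B" if "x \<in> J" for x using that J.add.subset by blast
  have tB: "t \<in> bcar B" using t JB by blast
  \<comment> \<open>Lambda is a homomorphism on the multiplicative group, so powers are used first;
    modulo \<open>E\<close> they agree with multiples, as \<open>J\<close> acts trivially
    there.\<close>
  define p where "p n = t [^]\<^bsub>mul_grp B\<^esub> n" for n :: nat
  have pJ: "p n \<in> J" for n
    by (induction n) (simp_all add: p_def t)
  note pB = JB[OF pJ]
  have pE: "coset E (p n) = coset E (n \<cdot> t)" for n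
  proof (induction n)
    case (Suc n)
    have "p (Suc n) = p n \<boxplus> lam (p n) t"
      using tB pB by (simp add: p_def times_conv_lam)
    then show ?case
      using E.coset_plus_cong[OF Suc lamE[OF pJ tB]] pB tB by simp
  qed (simp add: p_def)
  have "\<exists>i j. i < j \<and> (\<forall>b\<in>bcar B. lam (p i) b = lam (p j) b)"
  proof (rule pigeonhole_hom[of "\<lambda>n. lam (p n)" X E])
    show "lam (p n) \<in> hom (add_grp B) (add_grp B)" for n using lam_hom pB by blast
    show "lam (p n) x \<in> coset E x" if "x \<in> X" for n x
      using that X lamE[OF pJ] pB by (subst E.mem_coset_iff) auto
  qed (use E X in auto)
  then obtain i j where ij: "i < j" "\<And>b. b \<in> bcar B \<Longrightarrow> lam (p i) b = lam (p j) b"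
    by blast
  define u where "u = p (j - i)"
  have uJ: "u \<in> J" and uB: "u \<in> bcar B" using pJ pB by (simp_all add: u_def)
  have lam_u: "lam u b = b" if "b \<in> bcar B" for b
  proof -
    have "p j = p i \<boxdot> u"
      using \<open>i < j\<close> tB by (simp add: p_def u_def mul.nat_pow_mult)
    then show ?thesis using that ij(2)[of b] pB uB by (metis lam_closed lam_inject lam_times)
  qed
  have kuJ: "k \<cdot> u \<in> J" for k :: nat by (induction k) (simp_all add: uJ)
  note kuB = JB[OF kuJ]
  \<comment> \<open>Since \<open>u\<close> acts trivially, its additive multiples are also its
    multiplicative powers and stay in the kernel of lambda.\<close>
  have lam_ku: "lam (k \<cdot> u) b = b" if "b \<in> bcar B" for b and k :: nat
  proof (induction k)
    case (Suc k)
    have "Suc k \<cdot> u = u \<boxdot> k \<cdot> u"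
      using uB kuB by (subst add.nat_pow_Suc2) (simp_all add: times_conv_lam lam_u)
    then show ?case using Suc uB kuB lam_u that by (simp add: lam_times)
  qed (simp add: that)
  have "\<exists>k l :: nat. k < l \<and>
    (\<forall>b\<in>bcar B. k \<cdot> u \<boxplus> b \<boxplus> \<boxminus> (k \<cdot> u) = l \<cdot> u \<boxplus> b \<boxplus> \<boxminus> (l \<cdot> u))"
  proof (rule pigeonhole_hom[of "\<lambda>k b. k \<cdot> u \<boxplus> b \<boxplus> \<boxminus> (k \<cdot> u)" X E])
    show "(\<lambda>b. k \<cdot> u \<boxplus> b \<boxplus> \<boxminus> (k \<cdot> u)) \<in> hom (add_grp B) (add_grp B)" for k :: nat
      using kuB[of k] by (simp add: hom_def add.m_assoc)
    show "k \<cdot> u \<boxplus> x \<boxplus> \<boxminus> (k \<cdot> u) \<in> coset E x" if "x \<in> X" for k :: nat and x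
    proof -
      have xB: "x \<in> bcar B" using that X by blast
      have "coset E (k \<cdot> u \<boxplus> x \<boxplus> \<boxminus> (k \<cdot> u)) = coset E (x \<boxplus> k \<cdot> u \<boxplus> \<boxminus> (k \<cdot> u))"
        using E.coset_plus_cong[OF comE[OF kuJ xB] refl] xB kuB by simp
      then show ?thesis using xB kuB by (simp add: E.mem_coset_iff add.m_assoc)
    qed
  qed (use E X in auto)
  then obtain k l :: nat where kl: "k < l"
    "\<And>b. b \<in> bcar B \<Longrightarrow> k \<cdot> u \<boxplus> b \<boxplus> \<boxminus> (k \<cdot> u) = l \<cdot> u \<boxplus> b \<boxplus> \<boxminus> (l \<cdot> u)"
    by blast
  define s where "s = (l - k) \<cdot> u"
  have s: "s \<in> J" "s \<in> bcar B" using kuJ kuB by (simp_all add: s_def)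
  have "s \<boxplus> b = b \<boxplus> s" if b: "b \<in> bcar B" for b
  proof -
    have "l \<cdot> u = k \<cdot> u \<boxplus> s"
      using \<open>k < l\<close> uB by (simp add: s_def add.nat_pow_mult)
    \<comment> \<open>Conjugation by the multiple \<open>l\<close> of \<open>u\<close> is
      conjugation by \<open>s\<close> followed by conjugation by the multiple \<open>k\<close> of
      \<open>u\<close>; the latter cancels.\<close>
    then have "k \<cdot> u \<boxplus> b \<boxplus> \<boxminus> (k \<cdot> u) = k \<cdot> u \<boxplus> (s \<boxplus> b \<boxplus> \<boxminus> s) \<boxplus> \<boxminus> (k \<cdot> u)"
      using kl(2)[OF b] b s kuB by (simp add: add.inv_mult_group add.m_assoc)
    then have "b = s \<boxplus> b \<boxplus> \<boxminus> s" using b s kuB by simp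
    then show ?thesis using b s by (metis add.inv_closed add.inv_solve_right add.m_closed)
  qed
  then have "s \<in> soc B" using s lam_ku by (simp add: soc_def s_def)
  moreover have "coset E s = coset E (((j - i) * (l - k)) \<cdot> t)"
  proof -
    have "coset E (int (l - k) \<cdot> u) = coset E (int (l - k) \<cdot> ((j - i) \<cdot> t))"
      using E.coset_scale_cong[OF pE] pB tB by (simp add: u_def)
    then show ?thesis using tB by (simp add: s_def add.nat_pow_pow int_pow_int)
  qed
  moreover have "(j - i) * (l - k) > 0" using \<open>i < j\<close> \<open>k < l\<close> by simp
  ultimately show ?thesis using s that by blast
qed

section \<open>Ideals in the socle that meet a finite ideal trivially\<close>

lemma subgroup_scale_image:
  fixes k :: nat
  assumes S: "subgroup S (add_grp B)" "S \<subseteq> soc B"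
  shows "subgroup ((\<lambda>x. k \<cdot> x) ` S) (add_grp B)"
proof (rule subgroup.intro)
  have SB: "x \<in> bcar B" if "x \<in> S" for x using that S socD by blast
  show "(\<lambda>x. k \<cdot> x) ` S \<subseteq> carrier (add_grp B)" using SB by auto
  fix x y assume "x \<in> (\<lambda>x. k \<cdot> x) ` S" "y \<in> (\<lambda>x. k \<cdot> x) ` S"
  then obtain x' y' where xy: "x' \<in> S" "x = k \<cdot> x'" "y' \<in> S" "y = k \<cdot> y'" by blast
  then have "x' \<boxplus> y' = y' \<boxplus> x'" using S SB socD by blast
  then have "k \<cdot> (x' \<boxplus> y') = x \<boxplus> y"
    using xy SB add.pow_mult_distrib by simp
  moreover have "x' \<boxplus> y' \<in> S" using xy subgroup.m_closed[OF S(1)] by simp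
  ultimately show "x \<otimes>\<^bsub>add_grp B\<^esub> y \<in> (\<lambda>x. k \<cdot> x) ` S"
    by (metis mult_add_grp image_eqI)
next
  fix x assume "x \<in> (\<lambda>x. k \<cdot> x) ` S"
  then obtain x' where x: "x' \<in> S" "x = k \<cdot> x'" by blast
  then have "x' \<in> bcar B" using S socD by blast
  then have "k \<cdot> (\<boxminus> x') = \<boxminus> x" using x add.nat_pow_inv by simp
  moreover have "\<boxminus> x' \<in> S" using x subgroup.m_inv_closed[OF S(1)] by simp
  ultimately show "inv\<^bsub>add_grp B\<^esub> x \<in> (\<lambda>x. k \<cdot> x) ` S" by (metis inv_add_grp image_eqI)
next
  show "\<one>\<^bsub>add_grp B\<^esub> \<in> (\<lambda>x. k \<cdot> x) ` S"
    using subgroup.one_closed[OF S(1)] add.nat_pow_one by (metis image_eqI one_add_grp)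
qed

lemma scale_card_eq_zero:
  assumes "subgroup E (add_grp B)" "finite E" "x \<in> E"
  shows "card E \<cdot> x = \<^bold>0"
proof -
  interpret S: group "(add_grp B)\<lparr>carrier := E\<rparr>"
    using assms(1) subgroup.subgroup_is_group add.is_group by blast
  have "x [^]\<^bsub>(add_grp B)\<lparr>carrier := E\<rparr>\<^esub> card E = \<^bold>0"
    using S.pow_order_eq_1[of x] assms by (simp add: order_def)
  then show ?thesis by (simp add: add.nat_pow_consistent[symmetric])
qed

text \<open>\<open>K\<close> consists of the \<open>k\<close>-fold multiples of socle elements in
  \<open>J\<close>. Scaling commutes with lambda, which makes \<open>K\<close> an ideal, and a socle
  element from \<open>ex_soc_multiple\<close> bounds its index.\<close>

lemma ex_soc_ideal_avoiding:
  assumes E: "brace_ideal E B" "finite E" and J: "brace_ideal J B" and t: "t \<in> J"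
    and gen: "\<And>x. x \<in> J \<Longrightarrow> \<exists>k::int. coset E x = coset E (k \<cdot> t)"
    and inf: "\<And>k::int. k \<cdot> t \<in> E \<Longrightarrow> k = 0"
    and lamE: "\<And>x b. x \<in> J \<Longrightarrow> b \<in> bcar B \<Longrightarrow> coset E (lam x b) = coset E b"
    and comE: "\<And>x b. x \<in> J \<Longrightarrow> b \<in> bcar B \<Longrightarrow> coset E (x \<boxplus> b) = coset E (b \<boxplus> x)"
    and X: "finite X" "X \<subseteq> bcar B" "generate (add_grp B) X = bcar B"
  obtains K where "brace_ideal K B" "K \<subseteq> soc B" "K \<subseteq> J" "K \<inter> E = {\<^bold>0}"
    "finite (coset K ` J)" "\<And>y. y \<in> K \<Longrightarrow> \<exists>z\<in>J. y = z \<boxdot> z"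
proof -
  interpret E: skew_brace_ideal B E by unfold_locales fact
  interpret J: skew_brace_ideal B J by unfold_locales fact
  have JB: "x \<in> bcar B" if "x \<in> J" for x using that J.add.subset by blast
  have tB: "t \<in> bcar B" using t JB by blast
  define S where "S = soc B \<inter> J"
  define k where "k = 2 * card E"
  define K where "K = (\<lambda>x. k \<cdot> x) ` S"
  have "card E > 0" using E.add.one_closed \<open>finite E\<close> card_gt_0_iff by blast
  then have "k > 0" by (simp add: k_def)
  have S: "subgroup S (add_grp B)" "S \<subseteq> soc B"
    using subgroup_soc J.add.subgroup_axioms by (auto simp: S_def add.subgroups_Inter_pair)
  have SJ: "n \<cdot> x \<in> S" if "x \<in> S" for n :: nat and x
    using that subgroup.m_closed[OF S(1)] subgroup.one_closed[OF S(1)]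
    by (induction n) simp_all
  have KS: "K \<subseteq> S" using SJ by (auto simp: K_def)
  have subK: "subgroup K (add_grp B)" unfolding K_def by (rule subgroup_scale_image[OF S])
  have "lam b x \<in> K" if "b \<in> bcar B" "x \<in> K" for b x
    using that conj_soc J.lam_ideal JB by (force simp: K_def lam_nat_pow S_def)
  then have K: "brace_ideal K B" using brace_ideal_if_subset_soc[OF subK] KS S by blast
  interpret K: skew_brace_ideal B K by unfold_locales fact
  \<comment> \<open>If y = kx lies in \<open>E\<close> and x is congruent to jt, then jkt lies in
    \<open>E\<close>, which forces j = 0. So x itself lies in \<open>E\<close> and is annihilated by
    \<open>card E\<close>, a divisor of \<open>k\<close>.\<close>
  have "y = \<^bold>0" if "y \<in> K" "y \<in> E" for y
  proof -
    obtain x where x: "x \<in> S" "y = k \<cdot> x" using \<open>y \<in> K\<close> by (auto simp: K_def)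
    then have xB: "x \<in> bcar B" using S socD by blast
    have "x \<in> J" using x by (simp add: S_def)
    then obtain j :: int where j: "coset E x = coset E (j \<cdot> t)" using gen by blast
    have "coset E (int k \<cdot> x) = coset E (int k \<cdot> (j \<cdot> t))"
      using E.coset_scale_cong[OF j] xB tB by simp
    moreover have "coset E (int k \<cdot> x) = E" using x \<open>y \<in> E\<close> xB by (simp add: E.coset_eq_self int_pow_int)
    ultimately have "(j * int k) \<cdot> t \<in> E"
      using tB E.coset_eq_self[of "(j * int k) \<cdot> t"] by (simp add: add.int_pow_pow)
    then have "j = 0" using inf \<open>k > 0\<close> by fastforce
    then have "x \<in> E" using j xB coset_zero[OF E.add.subset] by (simp add: E.coset_eq_self)
    then have "card E \<cdot> x = \<^bold>0" using scale_card_eq_zero E.add.subgroup_axioms \<open>finite E\<close> by blast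
    then show ?thesis using x xB add.nat_pow_pow[of x "card E" 2] by (simp add: k_def mult.commute)
  qed
  then have "K \<inter> E = {\<^bold>0}" using K.add.one_closed E.add.one_closed by blast
  moreover have "\<exists>z\<in>J. y = z \<boxdot> z" if "y \<in> K" for y
  proof -
    obtain x where x: "x \<in> S" "y = k \<cdot> x" using \<open>y \<in> K\<close> by (auto simp: K_def)
    then have xB: "x \<in> bcar B" using S socD by blast
    \<comment> \<open>Half of the multiple: this element is in the socle, where squaring is
      doubling.\<close>
    let ?z = "card E \<cdot> x"
    have "?z \<in> S" using SJ x by blast
    then have "?z \<boxdot> ?z = ?z \<boxplus> ?z" using soc_times S socD by blast
    also have "\<dots> = y" using x xB by (simp add: k_def add.nat_pow_mult mult_2)
    finally show ?thesis using \<open>?z \<in> S\<close> by (auto simp: S_def)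
  qed
  moreover have "finite (coset K ` J)"
  proof -
    obtain s m where s: "s \<in> soc B" "s \<in> J" "m > (0::nat)" "coset E s = coset E (m \<cdot> t)"
      using ex_soc_multiple[OF E J t lamE comE X] by blast
    have sB: "s \<in> bcar B" using s JB by blast
    \<comment> \<open>\<open>w\<close> lies in \<open>K\<close> and is congruent to Nt modulo
      \<open>E\<close> with N > 0. Subtracting multiples of \<open>w\<close> reduces the coefficient
      of \<open>t\<close> modulo \<open>N\<close>, so \<open>N\<close> cosets of the finite
      \<open>E\<close> represent all of \<open>J\<close> modulo \<open>K\<close>.\<close>
    define w where "w = k \<cdot> s"
    define N where "N = int m * int k"
    have w: "w \<in> K" "w \<in> bcar B" using s sB by (auto simp: w_def K_def S_def)
    have wE: "coset E w = coset E (N \<cdot> t)"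
      using E.coset_scale_cong[OF s(4), of "int k"] sB tB
      by (simp add: w_def N_def int_pow_int add.int_pow_pow flip: add.int_pow_pow)
    have "N > 0" using s \<open>k > 0\<close> by (simp add: N_def)
    have "coset K ` J \<subseteq> coset K ` (\<Union>r\<in>{0..<N}. coset E (r \<cdot> t))"
    proof
      fix Y assume "Y \<in> coset K ` J"
      then obtain x where x: "x \<in> J" "Y = coset K x" by blast
      then have xB: "x \<in> bcar B" using JB by blast
      obtain j :: int where j: "coset E x = coset E (j \<cdot> t)" using gen x by blast
      define q where "q = j div N"
      define v where "v = \<boxminus> (q \<cdot> w)"
      have v: "v \<in> K" "v \<in> bcar B"
        using w add.subgroup_int_pow_closed[OF subK] K.add.m_inv_closed by (simp_all add: v_def)
      have "coset E v = coset E (\<boxminus> (q \<cdot> (N \<cdot> t)))"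
        unfolding v_def using E.coset_neg_cong[OF E.coset_scale_cong[OF wE]] w tB by simp
      then have "coset E (v \<boxplus> x) = coset E (\<boxminus> (q \<cdot> (N \<cdot> t)) \<boxplus> j \<cdot> t)"
        by (rule E.coset_plus_cong[OF _ j]) (use v xB tB in simp_all)
      also have "\<boxminus> (q \<cdot> (N \<cdot> t)) \<boxplus> j \<cdot> t = (j mod N) \<cdot> t"
      proof -
        have "(- (N * q) + j) \<cdot> t = \<boxminus> (q \<cdot> (N \<cdot> t)) \<boxplus> j \<cdot> t"
          using tB by (simp only: add.int_pow_mult add.int_pow_neg add.int_pow_pow)
        moreover have "- (N * q) + j = j mod N" by (simp add: q_def minus_mult_div_eq_mod[symmetric])
        ultimately show ?thesis by metis
      qed
      finally have "v \<boxplus> x \<in> coset E ((j mod N) \<cdot> t)"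
        using v xB tB by (simp add: E.mem_coset_iff)
      moreover have "coset K (v \<boxplus> x) = coset K x"
        using v xB by (simp add: K.coset_eq add.m_assoc)
      moreover have "j mod N \<in> {0..<N}" using \<open>N > 0\<close> by simp
      ultimately show "Y \<in> coset K ` (\<Union>r\<in>{0..<N}. coset E (r \<cdot> t))"
        using x by (metis UN_I image_eqI)
    qed
    moreover have "finite (coset E x)" for x using \<open>finite E\<close> by (simp add: r_coset_def)
    ultimately show ?thesis by (meson finite_UN finite_atLeastLessThan_int finite_imageI finite_subset)
  qed
  ultimately show ?thesis using K KS that by (auto simp: S_def)
qed

end

section \<open>Finite images, and cosets and lambda under quotients and restriction\<close>

lemma finite_image_factor:
  assumes "finite (f ` S)" and "\<And>x y. x \<in> S \<Longrightarrow> y \<in> S \<Longrightarrow> f x = f y \<Longrightarrow> g x = g y"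
  shows "finite (g ` S)"
proof -
  have "g ` S \<subseteq> (\<lambda>z. g (inv_into S f z)) ` (f ` S)"
  proof
    fix y assume "y \<in> g ` S"
    then obtain x where x: "x \<in> S" "y = g x" by blast
    then have "g (inv_into S f (f x)) = g x"
      by (intro assms(2) inv_into_into f_inv_into_f) auto
    then show "y \<in> (\<lambda>z. g (inv_into S f z)) ` (f ` S)" using x by force
  qed
  then show ?thesis using assms(1) finite_subset by blast
qed

text \<open>Turns congruences modulo an ideal I containing M into congruences modulo I/M in
  B/M.\<close>

lemma (in brace_epi) coset_image:
  assumes "I \<subseteq> bcar B" "x \<in> bcar B"
  shows "cod.coset (h ` I) (h x) = h ` coset I x"
  using assms by (force simp: r_coset_def hom_plus)

lemma bcar_quot_sub_brace: "bcar (quot (sub_brace B J) I) = quot_img B J I"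
  unfolding quot_sub_brace by (simp add: sub_brace_def)

text \<open>\<open>bneg\<close> is the inverse in a group with a given carrier, so restricting the
  carrier preserves it only because \<open>J\<close> is a subgroup.\<close>

lemma (in skew_brace) blam_sub_brace:
  assumes "subgroup J (add_grp B)" "x \<in> J"
  shows "blam (sub_brace B J) x y = lam x y"
proof -
  have "bneg (sub_brace B J) x = \<boxminus> x"
    using add.m_inv_consistent[OF assms] by (simp only: bneg_def add_grp_sub_brace)
  then show ?thesis by (simp add: blam_def) (simp add: sub_brace_def)
qed

section \<open>Infinite cyclic factors of a supersoluble chain\<close>

context skew_brace
begin

text \<open>For ideals I \<le> J this says that J/I is infinite cyclic, generated by the class of
  \<open>t\<close>, and contained in Soc(B/I). Congruences in \<open>B\<close> are used so that the
  condition transfers easily to other quotients.\<close>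

definition infinite_cyclic_factor :: "'a set \<Rightarrow> 'a set \<Rightarrow> 'a \<Rightarrow> bool" where
  "infinite_cyclic_factor I J t \<longleftrightarrow> t \<in> J \<and>
     (\<forall>x\<in>J. \<exists>k::int. coset I x = coset I (k \<cdot> t)) \<and> (\<forall>k::int. k \<cdot> t \<in> I \<longrightarrow> k = 0) \<and>
     (\<forall>x\<in>J. \<forall>b\<in>bcar B. coset I (lam x b) = coset I b \<and> coset I (x \<boxplus> b) = coset I (b \<boxplus> x))"

text \<open>\<open>t\<close> represents a generator of the factor. A nonzero multiple of
  \<open>t\<close> in \<open>I\<close> would allow coefficients to be reduced modulo it, making the
  factor finite.\<close>

lemma infinite_cyclic_factorI:
  assumes I: "brace_ideal I B" and J: "brace_ideal J B"
    and inf: "infinite (bcar (quot (sub_brace B J) I))"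
    and cyc: "cyclic_group (add_grp (quot (sub_brace B J) I))"
    and soc: "bcar (quot (sub_brace B J) I) \<subseteq> soc (quot B I)"
  shows "\<exists>t. infinite_cyclic_factor I J t"
proof -
  interpret I: skew_brace_ideal B I by unfold_locales fact
  interpret J: skew_brace_ideal B J by unfold_locales fact
  interpret q: brace_epi B "quot B I" "coset I" by (rule I.brace_epi_quot)
  interpret qJ: skew_brace_ideal "quot B I" "coset I ` J"
    using q.ideal_image J by unfold_locales blast
  let ?Q = "(add_grp (quot B I))\<lparr>carrier := coset I ` J\<rparr>"
  have Q: "add_grp (quot (sub_brace B J) I) = ?Q"
    by (simp add: quot_sub_brace add_grp_sub_brace quot_img_def)
  have carrier: "bcar (quot (sub_brace B J) I) = coset I ` J"
    by (simp add: bcar_quot_sub_brace quot_img_def)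
  interpret Q: group ?Q
    using subgroup.subgroup_is_group[OF qJ.add.subgroup_axioms] q.cod.add.is_group by simp
  have JB: "x \<in> bcar B" if "x \<in> J" for x using that J.add.subset by blast
  have "cyclic_group ?Q" using cyc unfolding Q .
  then obtain T where "T \<in> carrier ?Q" and T2: "carrier ?Q = range (\<lambda>n::int. T [^]\<^bsub>?Q\<^esub> n)"
    unfolding Q.cyclic_group by blast
  from \<open>T \<in> carrier ?Q\<close> have T1: "T \<in> coset I ` J" by simp
  then obtain t where t: "t \<in> J" "T = coset I t" by blast
  then have tB: "t \<in> bcar B" using JB by blast
  have "T [^]\<^bsub>?Q\<^esub> n = coset I (n \<cdot> t)" for n :: int
    using q.cod.add.int_pow_consistent[OF qJ.add.subgroup_axioms T1] q.add.hom_int_pow[OF tB] t(2)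
    by metis
  with T2 have "carrier ?Q = range (\<lambda>n::int. coset I (n \<cdot> t))" by presburger
  then have range: "coset I ` J = range (\<lambda>n::int. coset I (n \<cdot> t))" by simp
  have "k = 0" if k: "k \<cdot> t \<in> I" for k :: int
  proof (rule ccontr)
    assume "k \<noteq> 0"
    have "coset I (n \<cdot> t) = coset I ((n mod k) \<cdot> t)" for n
    proof -
      have "coset I ((k * (n div k)) \<cdot> t) = coset I \<^bold>0"
        using add.subgroup_int_pow_closed[OF I.add.subgroup_axioms k, of "n div k"] tB
          coset_zero[OF I.add.subset] by (simp add: I.coset_eq_self add.int_pow_pow)
      then have "coset I ((k * (n div k)) \<cdot> t \<boxplus> (n mod k) \<cdot> t) = coset I (\<^bold>0 \<boxplus> (n mod k) \<cdot> t)"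
        by (rule I.coset_plus_cong[OF _ refl]) (use tB in simp_all)
      then show ?thesis using tB add.int_pow_mult[OF tB, of "k * (n div k)" "n mod k"] by simp
    qed
    \<comment> \<open>\<open>n mod k\<close> takes the sign of \<open>k\<close>, which may be
      negative; hence the two-sided interval.\<close>
    moreover have "n mod k \<in> {-\<bar>k\<bar>..\<bar>k\<bar>}" for n
      using \<open>k \<noteq> 0\<close> abs_mod_less[of k n] by auto
    ultimately have "range (\<lambda>n::int. coset I (n \<cdot> t)) \<subseteq> (\<lambda>n. coset I (n \<cdot> t)) ` {-\<bar>k\<bar>..\<bar>k\<bar>}"
      by blast
    then have "finite (range (\<lambda>n::int. coset I (n \<cdot> t)))" by (rule finite_subset) simp
    then show False using inf carrier range by simp
  qed
  moreover have "coset I (lam x b) = coset I b \<and> coset I (x \<boxplus> b) = coset I (b \<boxplus> x)"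
    if "x \<in> J" "b \<in> bcar B" for x b
  proof -
    have "coset I x \<in> soc (quot B I)" using soc carrier that by blast
    moreover have "coset I b \<in> bcar (quot B I)" using q.surj that by blast
    ultimately show ?thesis
      using that JB q.cod.socD by (metis q.hom_lam q.hom_plus)
  qed
  moreover have "\<exists>k::int. coset I x = coset I (k \<cdot> t)" if "x \<in> J" for x
    using range that by blast
  ultimately show ?thesis using t unfolding infinite_cyclic_factor_def by blast
qed

text \<open>The brace acts on an infinite cyclic factor through automorphisms of the integers,
  hence by signs.\<close>

lemma lam_square_infinite_cyclic_factor:
  assumes I: "brace_ideal I B" and J: "brace_ideal J B" and t: "infinite_cyclic_factor I J t"
    and b: "b \<in> bcar B" and x: "x \<in> J"
  shows "coset I (lam (b \<boxdot> b) x) = coset I x"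
proof -
  interpret I: skew_brace_ideal B I by unfold_locales fact
  interpret J: skew_brace_ideal B J by unfold_locales fact
  interpret q: brace_epi B "quot B I" "coset I" by (rule I.brace_epi_quot)
  have JB: "x \<in> bcar B" if "x \<in> J" for x using that J.add.subset by blast
  have tJ: "t \<in> J" and gen: "\<And>x. x \<in> J \<Longrightarrow> \<exists>k::int. coset I x = coset I (k \<cdot> t)"
    and inf: "\<And>k::int. k \<cdot> t \<in> I \<Longrightarrow> k = 0"
    using t by (auto simp: infinite_cyclic_factor_def)
  note tB = JB[OF tJ]
  \<comment> \<open>On the factor, \<open>lam c\<close> is multiplication by the integer k that
    describes its effect on \<open>t\<close>.\<close>
  have lam_scale: "coset I (lam c y) = coset I ((j * k) \<cdot> t)"
    if "coset I (lam c t) = coset I (k \<cdot> t)" "coset I y = coset I (j \<cdot> t)"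
      "c \<in> bcar B" "y \<in> bcar B" for c y and j k :: int
  proof -
    have "coset I (lam c y) = coset I (lam c (j \<cdot> t))"
      using that tB by (simp add: q.hom_lam)
    also have "\<dots> = coset I (j \<cdot> lam c t)" using that tB by (simp add: lam_int_pow)
    also have "\<dots> = coset I (j \<cdot> (k \<cdot> t))"
      using I.coset_scale_cong[OF that(1)] that tB by simp
    finally show ?thesis using tB by (simp add: add.int_pow_pow mult.commute)
  qed
  obtain k :: int where k: "coset I (lam b t) = coset I (k \<cdot> t)"
    using gen J.lam_ideal[OF b tJ] by blast
  obtain l :: int where l: "coset I (lam (recip b) t) = coset I (l \<cdot> t)"
    using gen J.lam_ideal[OF _ tJ, of "recip b"] b by blast
  \<comment> \<open>Acting by \<open>b\<close> and then by its inverse fixes \<open>t\<close>, so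
    the two integer multipliers are mutually inverse and k is 1 or -1.\<close>
  have "coset I t = coset I ((k * l) \<cdot> t)"
    using lam_scale[OF l k] b tB by simp
  then have "(1 - k * l) \<cdot> t \<in> I" using tB by (simp add: I.coset_eq add.int_pow_diff)
  then have "k * l = 1" using inf by fastforce
  then have "k * k = 1" by (metis zmult_eq_1_iff mult_minus1 minus_minus mult_1)
  obtain j :: int where j: "coset I x = coset I (j \<cdot> t)" using gen x by blast
  have xB: "x \<in> bcar B" using x JB by blast
  have "coset I (lam b (lam b x)) = coset I ((j * k * k) \<cdot> t)"
    by (intro lam_scale k j b lam_closed xB)
  then show ?thesis using b xB j \<open>k * k = 1\<close> by (simp add: lam_times mult.assoc)
qed

section \<open>Finite index, generators and the central series across one factor\<close>

text \<open>With \<open>r x\<close> a chosen representative of the coset of x modulo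
  \<open>I\<close>, the class of x modulo \<open>M\<close> is determined by its class modulo
  \<open>I\<close> and the class of x - \<open>r x\<close> modulo \<open>M\<close>.\<close>

lemma finite_cosets_trans:
  assumes sub: "subgroup M (add_grp B)" "subgroup I (add_grp B)" and "J \<subseteq> bcar B"
    and fin: "finite (coset M ` I)" "finite (coset I ` J)"
  shows "finite (coset M ` J)"
proof -
  define r where "r x = inv_into J (coset I) (coset I x)" for x
  have r: "r x \<in> bcar B" "x \<boxplus> \<boxminus> r x \<in> I" if "x \<in> J" for x
  proof -
    have "r x \<in> J" "coset I (r x) = coset I x"
      using that by (simp_all add: r_def inv_into_into f_inv_into_f)
    then show "r x \<in> bcar B" "x \<boxplus> \<boxminus> r x \<in> I"
      using assms(3) that coset_eq_iff[OF sub(2), of x "r x"] by auto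
  qed
  have "(\<lambda>x. (coset I x, coset M (x \<boxplus> \<boxminus> r x))) ` J \<subseteq> (coset I ` J) \<times> (coset M ` I)"
    using r by auto
  then have "finite ((\<lambda>x. (coset I x, coset M (x \<boxplus> \<boxminus> r x))) ` J)"
    using fin by (meson finite_SigmaI finite_subset)
  then show ?thesis
  proof (rule finite_image_factor)
    fix x y assume xy: "x \<in> J" "y \<in> J"
      "(coset I x, coset M (x \<boxplus> \<boxminus> r x)) = (coset I y, coset M (y \<boxplus> \<boxminus> r y))"
    then have "r x = r y" and xyB: "x \<in> bcar B" "y \<in> bcar B" using assms(3) by (auto simp: r_def)
    then have "x \<boxplus> \<boxminus> r x \<boxplus> \<boxminus> (y \<boxplus> \<boxminus> r x) \<in> M"
      using xy r[OF xy(1)] coset_eq_iff[OF sub(1), of "x \<boxplus> \<boxminus> r x" "y \<boxplus> \<boxminus> r x"] by simp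
    then show "coset M x = coset M y"
      using xyB r[OF xy(1)] coset_eq_iff[OF sub(1)] by (simp add: add.inv_mult_group add.m_assoc)
  qed
qed

text \<open>Every x in \<open>J\<close> differs from some y generated by \<open>Y\<close> by an
  element of \<open>I\<close>. This is the induction step for finite generation of the additive
  group along the chain.\<close>

lemma generate_extend:
  assumes sub: "subgroup I (add_grp B)" "subgroup J (add_grp B)" and "I \<subseteq> J"
    and X: "X \<subseteq> bcar B" "generate (add_grp B) X = I"
    and Y: "Y \<subseteq> J" "\<And>x. x \<in> J \<Longrightarrow> \<exists>y\<in>generate (add_grp B) Y. coset I x = coset I y"
  shows "generate (add_grp B) (X \<union> Y) = J"
proof
  have JB: "J \<subseteq> bcar B" using subgroup.subset[OF sub(2)] by simp
  have XI: "X \<subseteq> I" unfolding X(2)[symmetric] by (auto intro: generate.incl)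
  then show "generate (add_grp B) (X \<union> Y) \<subseteq> J"
    using add.generate_subgroup_incl[OF _ sub(2), of "X \<union> Y"] Y(1) \<open>I \<subseteq> J\<close> by simp
  have XY: "X \<union> Y \<subseteq> bcar B" using X Y JB by blast
  show "J \<subseteq> generate (add_grp B) (X \<union> Y)"
  proof
    fix x assume x: "x \<in> J"
    then obtain y where y: "y \<in> generate (add_grp B) Y" "coset I x = coset I y" using Y by blast
    have yB: "y \<in> bcar B" using add.generate_in_carrier y Y(1) JB by blast
    then have "x \<boxplus> \<boxminus> y \<in> generate (add_grp B) X"
      using x y JB coset_eq_iff[OF sub(1), of x y] X by auto
    then have "x \<boxplus> \<boxminus> y \<in> generate (add_grp B) (X \<union> Y)"
      using add.mono_generate[of X "X \<union> Y"] by blast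
    moreover have "y \<in> generate (add_grp B) (X \<union> Y)"
      using y add.mono_generate[of Y "X \<union> Y"] by blast
    ultimately have "x \<boxplus> \<boxminus> y \<boxplus> y \<in> generate (add_grp B) (X \<union> Y)"
      using generate.eng[of _ "add_grp B" "X \<union> Y"] by simp
    then show "x \<in> generate (add_grp B) (X \<union> Y)" using x yB JB by (auto simp: add.m_assoc)
  qed
qed

text \<open>The induction step at an infinite factor: \<open>ex_soc_ideal_avoiding\<close> is
  applied in B/M to the finite ideal I/M, and \<open>M'\<close> is the preimage of the resulting
  \<open>K\<close>.\<close>

lemma ex_central_extension:
  assumes I: "brace_ideal I B" and J: "brace_ideal J B" and "I \<subseteq> J"
    and t: "infinite_cyclic_factor I J t"
    and M: "brace_ideal M B" "M \<subseteq> I" "M \<subseteq> H" and fin: "finite (coset M ` I)"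
    and H: "\<And>a b. a \<in> H \<Longrightarrow> b \<in> H \<Longrightarrow> a \<boxdot> b \<in> H" "\<And>b. b \<in> bcar B \<Longrightarrow> b \<boxdot> b \<in> H" "H \<subseteq> bcar B"
    and HJ: "\<And>b x. b \<in> H \<Longrightarrow> x \<in> J \<Longrightarrow> coset I (lam b x) = coset I x"
    and X: "finite X" "X \<subseteq> bcar B" "generate (add_grp B) X = bcar B"
  shows "\<exists>M'. brace_ideal M' B \<and> M \<subseteq> M' \<and> M' \<subseteq> J \<and> M' \<subseteq> H \<and> finite (coset M' ` J) \<and>
    coset M ` M' \<subseteq> soc (quot B M) \<and> (\<forall>b\<in>H. \<forall>x\<in>M'. coset M (lam b x) = coset M x)"
proof -
  interpret I: skew_brace_ideal B I by unfold_locales fact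
  interpret J: skew_brace_ideal B J by unfold_locales fact
  interpret M: skew_brace_ideal B M by unfold_locales fact
  interpret q: brace_epi B "quot B M" "coset M" by (rule M.brace_epi_quot)
  let ?E = "coset M ` I" and ?J = "coset M ` J"
  have JB: "x \<in> bcar B" if "x \<in> J" for x using that J.add.subset by blast
  have tJ: "t \<in> J" and gen: "\<And>x. x \<in> J \<Longrightarrow> \<exists>k::int. coset I x = coset I (k \<cdot> t)"
    and inf: "\<And>k::int. k \<cdot> t \<in> I \<Longrightarrow> k = 0"
    and lamI: "\<And>x b. x \<in> J \<Longrightarrow> b \<in> bcar B \<Longrightarrow> coset I (lam x b) = coset I b"
    and comI: "\<And>x b. x \<in> J \<Longrightarrow> b \<in> bcar B \<Longrightarrow> coset I (x \<boxplus> b) = coset I (b \<boxplus> x)"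
    using t by (auto simp: infinite_cyclic_factor_def)
  note tB = JB[OF tJ]
  have cosE: "q.cod.coset ?E (coset M x) = coset M ` coset I x" if "x \<in> bcar B" for x
    using q.coset_image[OF I.add.subset that] .
  \<comment> \<open>Membership in a subgroup containing \<open>M\<close> can be tested modulo
    \<open>M\<close>.\<close>
  have q_mem: "x \<in> N" if "coset M x \<in> coset M ` N" "x \<in> bcar B" "M \<subseteq> N" "subgroup N (add_grp B)" for x N
  proof -
    obtain y where y: "y \<in> N" "coset M x = coset M y" using \<open>coset M x \<in> coset M ` N\<close> by blast
    have "y \<in> bcar B" using y subgroup.subset[OF that(4)] by auto
    then have "x \<boxplus> \<boxminus> y \<in> N" "x = x \<boxplus> \<boxminus> y \<boxplus> y" using y that M.coset_eq add.m_assoc by auto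
    then show ?thesis using subgroup.m_closed[OF that(4) _ y(1)] by fastforce
  qed
  obtain K where K: "brace_ideal K (quot B M)" "K \<subseteq> soc (quot B M)" "K \<subseteq> ?J"
    "K \<inter> ?E = {bzero (quot B M)}" "finite (q.cod.coset K ` ?J)"
    "\<And>y. y \<in> K \<Longrightarrow> \<exists>z\<in>?J. y = bmul (quot B M) z z"
  proof (rule q.cod.ex_soc_ideal_avoiding[of ?E ?J "coset M t" "coset M ` X"])
    show "brace_ideal ?E (quot B M)" "brace_ideal ?J (quot B M)"
      using q.ideal_image I J by blast+
    show "\<exists>k::int. q.cod.coset ?E x = q.cod.coset ?E (q.cod.scale k (coset M t))" if "x \<in> ?J" for x
    proof -
      obtain y where y: "y \<in> J" "x = coset M y" using \<open>x \<in> ?J\<close> by blast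
      obtain k :: int where "coset I y = coset I (k \<cdot> t)" using gen y by blast
      then have "q.cod.coset ?E x = q.cod.coset ?E (coset M (k \<cdot> t))"
        using y JB tB cosE by simp
      then show ?thesis using q.add.hom_int_pow[OF tB, of k] by auto
    qed
    show "k = 0" if "q.cod.scale k (coset M t) \<in> ?E" for k :: int
      using q_mem[of "k \<cdot> t" I] that q.add.hom_int_pow[OF tB, of k] tB M I.add.subgroup_axioms inf
      by simp
    fix x b assume "x \<in> ?J" "b \<in> bcar (quot B M)"
    then obtain y c where y: "y \<in> J" "x = coset M y" and c: "c \<in> bcar B" "b = coset M c"
      using q.surj by blast
    note yB = JB[OF y(1)]
    show "q.cod.coset ?E (q.cod.lam x b) = q.cod.coset ?E b"
      using lamI[OF y(1) c(1)] y c yB cosE[of "lam y c"] cosE[of c] by (simp add: q.hom_lam)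
    show "q.cod.coset ?E (q.cod.plus x b) = q.cod.coset ?E (q.cod.plus b x)"
      using comI[OF y(1) c(1)] y c yB cosE[of "y \<boxplus> c"] cosE[of "c \<boxplus> y"] by (simp add: q.hom_plus)
  next
    show "generate (add_grp (quot B M)) (coset M ` X) = bcar (quot B M)"
      using q.add.generate_img[of X] X q.surj by simp
  qed (use fin tJ X q.surj in auto)
  interpret K: skew_brace_ideal "quot B M" K by unfold_locales fact
  define M' where "M' = {x \<in> bcar B. coset M x \<in> K}"
  have M': "brace_ideal M' B" unfolding M'_def by (rule q.ideal_vimage[OF K(1)])
  interpret M': skew_brace_ideal B M' by unfold_locales fact
  have M'D: "x \<in> bcar B" "coset M x \<in> K" if "x \<in> M'" for x
    using that unfolding M'_def by blast+
  have "x \<in> bcar B \<and> coset M x \<in> K" if "x \<in> M" for x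
  proof -
    have "x \<in> bcar B" using that M.add.subset by blast
    moreover have "coset M x = bzero (quot B M)"
      using that calculation by (simp add: M.coset_eq_self quot_def)
    ultimately show ?thesis using K.add.one_closed by simp
  qed
  then have "M \<subseteq> M'" unfolding M'_def by blast
  moreover have "M' \<subseteq> J"
  proof
    fix x assume x: "x \<in> M'"
    have "coset M x \<in> ?J" by (rule subsetD[OF K(3) M'D(2)[OF x]])
    moreover have "M \<subseteq> J" using M(2) \<open>I \<subseteq> J\<close> by blast
    ultimately show "x \<in> J" by (rule q_mem[OF _ M'D(1)[OF x] _ J.add.subgroup_axioms])
  qed
  moreover have "M' \<subseteq> H"
  proof
    fix x assume x: "x \<in> M'"
    obtain z where z: "z \<in> J" "coset M x = bmul (quot B M) (coset M z) (coset M z)"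
      using K(6)[OF M'D(2)[OF x]] by blast
    have zB: "z \<in> bcar B" using z JB by blast
    have xB: "x \<in> bcar B" using x M'.add.subset by blast
    have zz: "z \<boxdot> z \<in> bcar B" using zB by simp
    have "coset M x = coset M (z \<boxdot> z)" using z zB by (simp add: q.hom_times)
    \<comment> \<open>The multiplicative coset is needed here: it writes x as a product of an
      element of \<open>M\<close> and a square, both in \<open>H\<close>, and \<open>H\<close> is
      closed under products.\<close>
    then have "x \<in> M #>\<^bsub>mul_grp B\<^esub> (z \<boxdot> z)"
      unfolding M.mul_coset_eq_coset[OF zz] M.mem_coset_iff[OF xB zz] .
    then obtain m where "m \<in> M" "x = m \<boxdot> (z \<boxdot> z)" by (auto simp: r_coset_def)
    then show "x \<in> H" using M H zB by blast
  qed
  moreover have "finite (coset M' ` J)"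
  proof (rule finite_image_factor)
    show "finite ((\<lambda>x. q.cod.coset K (coset M x)) ` J)"
      using K(5) by (simp add: image_image)
    fix x y assume xy: "x \<in> J" "y \<in> J" "q.cod.coset K (coset M x) = q.cod.coset K (coset M y)"
    then have xyB: "x \<in> bcar B" "y \<in> bcar B" using JB by blast+
    then have "coset M (x \<boxplus> \<boxminus> y) \<in> K"
      using xy q.surj K.coset_eq[of "coset M x" "coset M y"] by (simp add: q.hom_plus)
    then have "x \<boxplus> \<boxminus> y \<in> M'" unfolding M'_def using xyB by blast
    then show "coset M' x = coset M' y" unfolding M'.coset_eq[OF xyB] .
  qed
  moreover have "coset M ` M' \<subseteq> soc (quot B M)" using K(2) M'D(2) by blast
  moreover have "coset M (lam b x) = coset M x" if "b \<in> H" "x \<in> M'" for b x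
  proof -
    have B: "b \<in> bcar B" "x \<in> bcar B" using that H M'.add.subset by blast+
    \<comment> \<open>The difference lies in \<open>I\<close>, as \<open>H\<close> centralises J/I,
      and in the ideal \<open>M'\<close>; its class is thus in the trivial intersection of
      \<open>K\<close> with I/M.\<close>
    have "lam b x \<boxplus> \<boxminus> x \<in> I" using HJ that \<open>M' \<subseteq> J\<close> B I.coset_eq[of "lam b x" x] by auto
    moreover have "lam b x \<boxplus> \<boxminus> x \<in> M'" using M'.lam_ideal that B by simp
    ultimately have "coset M (lam b x \<boxplus> \<boxminus> x) \<in> K \<inter> ?E" using M'D(2) by blast
    then have "coset M (lam b x \<boxplus> \<boxminus> x) = M" unfolding K(4) unfolding quot_def by simp
    then show ?thesis
      using B M.coset_eq_self[of "lam b x \<boxplus> \<boxminus> x"] M.coset_eq[of "lam b x" x] by blast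
  qed
  ultimately show ?thesis using M' by blast
qed

section \<open>Central nilpotency and the index of the Fitting ideal\<close>

text \<open>A socle element X that is fixed by \<open>lam Y\<close> commutes with Y
  multiplicatively: YX = Y + X = X + Y = XY. So socle factors centralised by \<open>M n\<close> are
  central in the quotients of \<open>M n\<close>.\<close>

lemma centrally_nilpotent_idealI:
  fixes M :: "nat \<Rightarrow> 'a set"
  assumes M0: "M 0 = {\<^bold>0}" and M: "\<And>i. i \<le> n \<Longrightarrow> brace_ideal (M i) B"
    and mono: "\<And>i. i < n \<Longrightarrow> M i \<subseteq> M (Suc i)"
    and soc: "\<And>i. i < n \<Longrightarrow> coset (M i) ` M (Suc i) \<subseteq> soc (quot B (M i))"
    and lam: "\<And>i b x. i < n \<Longrightarrow> b \<in> M n \<Longrightarrow> x \<in> M (Suc i) \<Longrightarrow> coset (M i) (lam b x) = coset (M i) x"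
  shows "centrally_nilpotent_ideal B (M n)"
proof -
  have Mn: "M i \<subseteq> M n" if "i \<le> n" for i
    using that by (induction rule: inc_induct) (use mono in blast)+
  have "quot_img B (M (Suc i)) (M i) \<subseteq> zeta (quot (sub_brace B (M n)) (M i))" if "i < n" for i
  proof
    interpret Mi: skew_brace_ideal B "M i" using M[of i] that by unfold_locales simp
    interpret Mn: skew_brace_ideal B "M n" using M[of n] by unfold_locales simp
    interpret q: brace_epi B "quot B (M i)" "coset (M i)" by (rule Mi.brace_epi_quot)
    interpret qn: skew_brace_ideal "quot B (M i)" "coset (M i) ` M n"
      using q.ideal_image[of "M n"] M[of n] by unfold_locales simp
    let ?Q = "quot B (M i)" and ?N = "coset (M i) ` M n"
    fix X assume "X \<in> quot_img B (M (Suc i)) (M i)"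
    then obtain x where x: "x \<in> M (Suc i)" "X = coset (M i) x" by (auto simp: quot_img_def)
    then have X: "X \<in> ?N" "X \<in> soc ?Q" using Mn[of "Suc i"] soc[of i] that by auto
    have xB: "x \<in> bcar B" using x Mn[of "Suc i"] that Mn.add.subset by auto
    have "blam (sub_brace ?Q ?N) X Y = Y \<and> badd ?Q X Y = badd ?Q Y X \<and> bmul ?Q X Y = bmul ?Q Y X"
      if "Y \<in> ?N" for Y
    proof -
      obtain y where y: "y \<in> M n" "Y = coset (M i) y" using \<open>Y \<in> ?N\<close> by blast
      then have yB: "y \<in> bcar B" using Mn.add.subset by blast
      have YQ: "Y \<in> bcar ?Q" using \<open>Y \<in> ?N\<close> qn.add.subset by blast
      have "q.cod.lam Y X = X"
        using lam[OF \<open>i < n\<close> y(1) x(1)] x y xB yB by (simp flip: q.hom_lam)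
      then have "bmul ?Q Y X = badd ?Q Y X"
        using YQ X(2) q.cod.socD(1) q.cod.times_conv_lam by metis
      then show ?thesis
        using YQ X q.cod.socD q.cod.soc_times q.cod.blam_sub_brace[OF qn.add.subgroup_axioms X(1)]
        by metis
    qed
    then show "X \<in> zeta (quot (sub_brace B (M n)) (M i))"
      using X(1) unfolding zeta_def soc_def quot_sub_brace quot_img_def
      by (simp add: sub_brace_def)
  qed
  then show ?thesis
    unfolding centrally_nilpotent_ideal_def using M M0 mono by blast
qed

text \<open>\<open>M\<close> is among the ideals generating \<open>Fit B\<close>, so cosets of
  \<open>M\<close> refine those of \<open>Fit B\<close>.\<close>

lemma finite_quot_Fit_if_finite_cosets:
  assumes M: "centrally_nilpotent_ideal B M" and fin: "finite (coset M ` bcar B)"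
  shows "finite (bcar (quot B (Fit B)))"
proof -
  let ?U = "\<Union>{I. centrally_nilpotent_ideal B I}"
  have "I \<subseteq> bcar B" if "centrally_nilpotent_ideal B I" for I
    using that normal_imp_subgroup[THEN subgroup.subset, of I "add_grp B"]
    by (auto simp: centrally_nilpotent_ideal_def brace_ideal_def)
  then have "subgroup (Fit B) (add_grp B)"
    unfolding Fit_def by (intro add.generate_is_subgroup) auto
  moreover have "M \<subseteq> Fit B" using M generate.incl[of _ ?U] by (auto simp: Fit_def)
  moreover have "subgroup M (add_grp B)"
    using M normal_imp_subgroup by (auto simp: centrally_nilpotent_ideal_def brace_ideal_def)
  ultimately have "coset (Fit B) x = coset (Fit B) y"
    if "x \<in> bcar B" "y \<in> bcar B" "coset M x = coset M y" for x y
    using that coset_eq_iff by blast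
  then have "finite (coset (Fit B) ` bcar B)" by (rule finite_image_factor[OF fin])
  then show ?thesis unfolding bcar_quot quot_img_def .
qed

section \<open>Construction of the central chain in a supersoluble brace\<close>

theorem finite_quot_Fit:
  assumes "supersoluble B"
  shows "finite (bcar (quot B (Fit B)))"
proof -
  obtain J n where J0: "J 0 = {\<^bold>0}" and Jn: "J n = bcar B" and J: "\<And>i. i \<le> n \<Longrightarrow> brace_ideal (J i) B"
    and mono: "\<And>i. i < n \<Longrightarrow> J i \<subseteq> J (Suc i)"
    and factor: "\<And>i. i < n \<Longrightarrow> (infinite (bcar (quot (sub_brace B (J (Suc i))) (J i))) \<and>
        cyclic_group (add_grp (quot (sub_brace B (J (Suc i))) (J i))) \<and>
        bcar (quot (sub_brace B (J (Suc i))) (J i)) \<subseteq> soc (quot B (J i)))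
      \<or> Factorial_Ring.prime (card (bcar (quot (sub_brace B (J (Suc i))) (J i))))"
    using assms unfolding supersoluble_def Let_def by metis
  define cyc where "cyc i \<longleftrightarrow> (\<exists>t. infinite_cyclic_factor (J i) (J (Suc i)) t)" for i
  have factor: "cyc i \<or> finite (coset (J i) ` J (Suc i))" if "i < n" for i
  proof (cases "finite (bcar (quot (sub_brace B (J (Suc i))) (J i)))")
    case True
    then show ?thesis by (simp add: bcar_quot_sub_brace quot_img_def)
  next
    case False
    \<comment> \<open>An infinite set has \<open>card\<close> equal to 0, which is not prime, so
      only the cyclic alternative remains.\<close>
    then have "\<not> Factorial_Ring.prime (card (bcar (quot (sub_brace B (J (Suc i))) (J i))))"
      by simp
    then show ?thesis
      using factor[OF that] infinite_cyclic_factorI J that by (auto simp: cyc_def)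
  qed
  have sub: "subgroup (J i) (add_grp B)" if "i \<le> n" for i
    using J[OF that] normal_imp_subgroup by (auto simp: brace_ideal_def)
  have JB: "J i \<subseteq> bcar B" if "i \<le> n" for i
    using subgroup.subset[OF sub[OF that]] by simp
  \<comment> \<open>The additive group is finitely generated: each factor contributes a cyclic
    generator or finitely many coset representatives.\<close>
  have "\<exists>X. finite X \<and> X \<subseteq> bcar B \<and> generate (add_grp B) X = J i" if "i \<le> n" for i
    using that
  proof (induction i)
    case 0
    then show ?case using J0 add.generate_empty by (metis empty_subsetI finite.emptyI)
  next
    case (Suc i)
    then obtain X where X: "finite X" "X \<subseteq> bcar B" "generate (add_grp B) X = J i" by auto
    have "\<exists>Y. finite Y \<and> Y \<subseteq> J (Suc i) \<and>
      (\<forall>x\<in>J (Suc i). \<exists>y\<in>generate (add_grp B) Y. coset (J i) x = coset (J i) y)"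
    proof (cases "cyc i")
      case True
      then obtain t where t: "infinite_cyclic_factor (J i) (J (Suc i)) t" by (auto simp: cyc_def)
      then have "t \<in> bcar B" using JB Suc by (auto simp: infinite_cyclic_factor_def)
      then have "k \<cdot> t \<in> generate (add_grp B) {t}" for k :: int
        using add.generate_pow[of t] by auto
      then show ?thesis using t unfolding infinite_cyclic_factor_def
        by (intro exI[of _ "{t}"]) (simp, metis)
    next
      case False
      then have "finite (coset (J i) ` J (Suc i))" using factor[of i] Suc.prems by simp
      then obtain Y where Y: "Y \<subseteq> J (Suc i)" "finite Y" "coset (J i) ` J (Suc i) = coset (J i) ` Y"
        using finite_subset_image[of "coset (J i) ` J (Suc i)" "coset (J i)" "J (Suc i)"] by blast
      have "\<exists>y\<in>generate (add_grp B) Y. coset (J i) x = coset (J i) y" if "x \<in> J (Suc i)" for x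
      proof -
        have "coset (J i) x \<in> coset (J i) ` Y" unfolding Y(3)[symmetric] using that by (rule imageI)
        then obtain y where "y \<in> Y" "coset (J i) x = coset (J i) y" by blast
        then show ?thesis by (intro bexI[of _ y] generate.incl)
      qed
      then show ?thesis using Y(1,2) by blast
    qed
    then obtain Y where "finite Y" "Y \<subseteq> J (Suc i)"
      "\<And>x. x \<in> J (Suc i) \<Longrightarrow> \<exists>y\<in>generate (add_grp B) Y. coset (J i) x = coset (J i) y" by blast
    then have "generate (add_grp B) (X \<union> Y) = J (Suc i)" "finite (X \<union> Y)" "X \<union> Y \<subseteq> bcar B"
      using generate_extend[OF sub sub mono X(2,3)] Suc X JB[of "Suc i"] by auto
    then show ?case by blast
  qed
  then obtain X where X: "finite X" "X \<subseteq> bcar B" "generate (add_grp B) X = bcar B"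
    using Jn by (metis le_refl)
  define H where "H = {b \<in> bcar B. \<forall>i<n. cyc i \<longrightarrow>
    (\<forall>x\<in>J (Suc i). coset (J i) (lam b x) = coset (J i) x)}"
  have H_times: "a \<boxdot> b \<in> H" if "a \<in> H" "b \<in> H" for a b
  proof -
    have B: "a \<in> bcar B" "b \<in> bcar B" using that by (simp_all add: H_def)
    have "coset (J i) (lam (a \<boxdot> b) x) = coset (J i) x" if i: "i < n" "cyc i" "x \<in> J (Suc i)" for i x
    proof -
      interpret Js: skew_brace_ideal B "J (Suc i)" using J[of "Suc i"] i by unfold_locales simp
      \<comment> \<open>\<open>lam b x\<close> must stay in the factor for the triviality of the
        action of \<open>a\<close> to apply to it.\<close>
      have "lam b x \<in> J (Suc i)" using Js.lam_ideal B i by simp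
      moreover have "x \<in> bcar B" using i Js.add.subset by blast
      ultimately show ?thesis using \<open>a \<in> H\<close> \<open>b \<in> H\<close> i B by (simp add: H_def lam_times)
    qed
    then show ?thesis using B by (simp add: H_def)
  qed
  have H_square: "b \<boxdot> b \<in> H" if "b \<in> bcar B" for b
  proof -
    have "coset (J i) (lam (b \<boxdot> b) x) = coset (J i) x" if "i < n" "cyc i" "x \<in> J (Suc i)" for i x
    proof -
      obtain t where t: "infinite_cyclic_factor (J i) (J (Suc i)) t"
        using \<open>cyc i\<close> unfolding cyc_def by blast
      show ?thesis
        by (rule lam_square_infinite_cyclic_factor[OF J J t \<open>b \<in> bcar B\<close>]) (use that in simp_all)
    qed
    then show ?thesis using that by (simp add: H_def)
  qed
  have HB: "H \<subseteq> bcar B" by (auto simp: H_def)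
  \<comment> \<open>The guards make both conditions vacuous beyond the end of the chain, so that the
    choice can run over all natural numbers.\<close>
  let ?P = "\<lambda>i M. i \<le> n \<longrightarrow> brace_ideal M B \<and> M \<subseteq> J i \<and> M \<subseteq> H \<and> finite (coset M ` J i)"
  let ?R = "\<lambda>i M M'. i < n \<longrightarrow> M \<subseteq> M' \<and> coset M ` M' \<subseteq> soc (quot B M) \<and>
    (\<forall>b\<in>H. \<forall>x\<in>M'. coset M (lam b x) = coset M x)"
  \<comment> \<open>Each term depends on the previous one, so dependent choice is used; the clause
    for \<open>i = 0\<close> fixes the start of the chain.\<close>
  have "\<exists>M. \<forall>i. (?P i (M i) \<and> (i = 0 \<longrightarrow> M i = {\<^bold>0})) \<and> ?R i (M i) (M (Suc i))"
  proof (rule dependent_nat_choice)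
    have "x \<in> bcar B" if "x \<in> J (Suc i)" "i < n" for x i using that JB[of "Suc i"] by auto
    then have "\<^bold>0 \<in> H" by (auto simp: H_def)
    then show "\<exists>M. ?P 0 M \<and> (0 = (0::nat) \<longrightarrow> M = {\<^bold>0})"
      using J[of 0] J0 by (intro exI[of _ "{\<^bold>0}"]) simp
  next
    fix M i assume M: "?P i M \<and> (i = 0 \<longrightarrow> M = {\<^bold>0})"
    show "\<exists>M'. (?P (Suc i) M' \<and> (Suc i = 0 \<longrightarrow> M' = {\<^bold>0})) \<and> ?R i M M'"
    proof (cases "i < n")
      case True
      with M have M: "brace_ideal M B" "M \<subseteq> J i" "M \<subseteq> H" "finite (coset M ` J i)" by simp_all
      interpret M: skew_brace_ideal B M by unfold_locales fact
      interpret q: brace_epi B "quot B M" "coset M" by (rule M.brace_epi_quot)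
      show ?thesis
      proof (cases "cyc i")
        case cyc: True
        then obtain t where t: "infinite_cyclic_factor (J i) (J (Suc i)) t" by (auto simp: cyc_def)
        have H_lam: "coset (J i) (lam b x) = coset (J i) x" if "b \<in> H" "x \<in> J (Suc i)" for b x
          using that cyc True by (simp add: H_def)
        have le: "i \<le> n" "Suc i \<le> n" using True by simp_all
        obtain M' where "brace_ideal M' B \<and> M \<subseteq> M' \<and> M' \<subseteq> J (Suc i) \<and> M' \<subseteq> H \<and>
          finite (coset M' ` J (Suc i)) \<and> coset M ` M' \<subseteq> soc (quot B M) \<and>
          (\<forall>b\<in>H. \<forall>x\<in>M'. coset M (lam b x) = coset M x)"
          using ex_central_extension[OF J[OF le(1)] J[OF le(2)] mono[OF True] t M
              H_times H_square HB H_lam X] ..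
        then show ?thesis by (intro exI[of _ M']) simp
      next
        case False
        \<comment> \<open>At a finite factor the same \<open>M\<close> is kept: its index stays
          finite and the conditions on the trivial factor M/M are immediate.\<close>
        then have "finite (coset M ` J (Suc i))"
          using finite_cosets_trans[OF M.add.subgroup_axioms sub JB M(4)] factor[of i] True by simp
        moreover have "coset M x = M" if "x \<in> M" for x
          using that M.coset_eq_self M.add.subset by blast
        moreover have "lam b x \<in> M" if "b \<in> H" "x \<in> M" for b x
          using that M.lam_ideal HB by blast
        moreover have "M \<in> soc (quot B M)"
          using subgroup.one_closed[OF q.cod.subgroup_soc] by (simp add: quot_def)
        ultimately show ?thesis
          using M mono[OF True] by (intro exI[of _ M]) auto
      qed
    qed simp
  qed
  then obtain M where M0: "M 0 = {\<^bold>0}" and M: "\<And>i. ?P i (M i)" and R: "\<And>i. ?R i (M i) (M (Suc i))"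
    by metis
  have "centrally_nilpotent_ideal B (M n)"
  proof (rule centrally_nilpotent_idealI[of M, OF M0])
    \<comment> \<open>Centralisation by \<open>H\<close> specialises to \<open>M n\<close>, since
      \<open>M n\<close> is contained in \<open>H\<close>.\<close>
    show "coset (M i) (lam b x) = coset (M i) x" if "i < n" "b \<in> M n" "x \<in> M (Suc i)" for i b x
      using R[of i] M[of n] that by blast
    show "brace_ideal (M i) B" if "i \<le> n" for i using M[of i] that by simp
    fix i assume "i < n"
    then show "M i \<subseteq> M (Suc i)" "coset (M i) ` M (Suc i) \<subseteq> soc (quot B (M i))"
      using R[of i] by simp_all
  qed
  moreover have "finite (coset (M n) ` bcar B)" using M[of n] Jn by simp
  ultimately show ?thesis by (rule finite_quot_Fit_if_finite_cosets)
qed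

end

theorem theorem3p42:
  fixes B :: "'a brace"
  assumes "is_brace B" and "supersoluble B"
  shows "finite (bcar (quot B (Fit B)))"
  using skew_brace.finite_quot_Fit[OF skew_brace.intro] assms by blast

end
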